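(* For all $\alpha,\nu\in\mathbb C$ and $x>0$, $$\mathbf W_{\alpha,\nu}(x)=\int_{-\infty}^{\infty}e^{\nu s}\,\eta_x(s)\,ds=2\int_0^\infty\cosh(\nu s)\,\eta_x(s)\,ds,$$ where $$\eta_x(s):=2^{-3/2}\pi^{-1/2}x^{-1+2\alpha}\exp\Bigl(\frac1{2x^2}-\frac1{4x^2}\cosh^2\bigl(\tfrac s2\bigr)\Bigr)D_{2\alpha}\Bigl(\frac1x\cosh\bigl(\tfrac s2\bigr)\Bigr),$$ the integrals converging absolutely.
   Context: For $\alpha,\nu\in\mathbb C$ and $x>0$, $\mathbf W_{\alpha,\nu}(x):=2^\alpha x^{2\alpha}e^{1/(4x^2)}W_{\alpha,\nu}\bigl(\tfrac1{2x^2}\bigr)=(2x^2)^{-\frac12+\alpha+\nu}\Psi\bigl(\tfrac12-\alpha-\nu,1-2\nu;\tfrac1{2x^2}\bigr)$, where $W_{\kappa,\mu}$ is the Whittaker function of the second kind and $\Psi$ the Tricomi confluent hypergeometric function. $D_\mu$ denotes the parabolic cylinder function. *)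

theory Defs
  imports "HOL-Analysis.Analysis"
begin

text \<open>Whittaker function of the second kind W_{kappa,mu}(z) for real z > 0:
  the unique solution of Whittaker's equation
  w'' + (-1/4 + kappa/z + (1/4 - mu^2)/z^2) w = 0 on (0,inf)
  with W(z) ~ z^kappa e^{-z/2} as z -> +inf (DLMF 13.14.21).
  Values for z <= 0 are fixed to 0 (they are never used).\<close>
definition whittaker_W :: "complex \<Rightarrow> complex \<Rightarrow> real \<Rightarrow> complex" where
  "whittaker_W \<kappa> \<mu> = (THE f.
     (\<forall>z. z \<le> 0 \<longrightarrow> f z = 0) \<and>
     (\<exists>g. (\<forall>z>0. (f has_vector_derivative g z) (at z)) \<and>
          (\<forall>z>0. (g has_vector_derivative
              ((1/4 - \<kappa> / of_real z + (\<mu>\<^sup>2 - 1/4) / (of_real z)\<^sup>2) * f z)) (at z))) \<and>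
     ((\<lambda>z. f z / (exp (- of_real z / 2) * of_real z powr \<kappa>)) \<longlongrightarrow> 1) at_top)"

text \<open>Parabolic cylinder function D_mu(z) for real z: the unique solution of Weber's
  equation w'' = (z^2/4 - mu - 1/2) w on the real line with
  D_mu(z) ~ z^mu e^{-z^2/4} as z -> +inf (DLMF 12.9.1).\<close>
definition parabolic_D :: "complex \<Rightarrow> real \<Rightarrow> complex" where
  "parabolic_D \<mu> = (THE f.
     (\<exists>g. (\<forall>z. (f has_vector_derivative g z) (at z)) \<and>
          (\<forall>z. (g has_vector_derivative
              ((of_real (z\<^sup>2 / 4) - \<mu> - 1/2) * f z)) (at z))) \<and>
     ((\<lambda>z. f z / (exp (- of_real (z\<^sup>2 / 4)) * of_real z powr \<mu>)) \<longlongrightarrow> 1) at_top)"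

definition boldW :: "complex \<Rightarrow> complex \<Rightarrow> real \<Rightarrow> complex" where
  "boldW \<alpha> \<nu> x = (2::complex) powr \<alpha> * of_real x powr (2 * \<alpha>)
      * of_real (exp (1 / (4 * x\<^sup>2))) * whittaker_W \<alpha> \<nu> (1 / (2 * x\<^sup>2))"

definition eta :: "complex \<Rightarrow> real \<Rightarrow> real \<Rightarrow> complex" where
  "eta \<alpha> x s = of_real (2 powr (-3/2) * pi powr (-1/2)) * of_real x powr (-1 + 2 * \<alpha>)
      * of_real (exp (1 / (2 * x\<^sup>2) - (cosh (s/2))\<^sup>2 / (4 * x\<^sup>2)))
      * parabolic_D (2 * \<alpha>) (cosh (s/2) / x)"

end

theory Submission
  imports Defs "HOL-Probability.Distributions" "HOL-Real_Asymp.Real_Asymp"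
begin

text \<open>
  Both special functions are pinned down as recessive solutions of an equation \<open>w'' = q w\<close>: the
  Wronskian of two such solutions is constant and tends to 0, so they are proportional, and the
  normalisation at infinity makes them equal.

  For \<open>Re \<mu> < 0\<close> the function \<open>D\<^bsub>\<mu>\<^esub>\<close> is \<open>exp (- z\<^sup>2 / 4) / \<Gamma>(-\<mu>)\<close> times the integral of
  \<open>t\<^bsup>-\<mu>-1\<^esup> exp (- t\<^sup>2 / 2 - z t)\<close> over \<open>t > 0\<close>, and the raising operator \<open>D \<mapsto> z D / 2 - D'\<close> passes
  from \<open>\<mu>\<close> to \<open>\<mu> + 1\<close>. In terms of \<open>F\<^bsub>\<mu>\<^esub> u = exp (- u\<^sup>2 / 4) D\<^bsub>\<mu>\<^esub> u\<close> this says \<open>F\<^bsub>\<mu>\<^esub>' = - F\<^bsub>\<mu>+1\<^esub>\<close>.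

  Let \<open>J y\<close> be the integral of \<open>exp (\<nu> s) F\<^bsub>2\<alpha>\<^esub> (y cosh (s / 2))\<close> over the real line. Differentiation
  under the integral and two integrations by parts in \<open>s\<close> give a second-order equation for \<open>J\<close>. In
  the variable \<open>z = y\<^sup>2 / 2\<close> its normal form, satisfied by \<open>\<surd>z exp (z / 2) J (\<surd>(2 z))\<close>, is Whittaker's
  equation with parameters \<open>\<alpha>, \<nu>\<close>. Laplace's method gives the behaviour at infinity, so by uniqueness
  this is a multiple of \<open>W\<^bsub>\<alpha>,\<nu>\<^esub>\<close>.
\<close>

section \<open>Recessive solutions of linear second-order equations\<close>

lemma has_vector_derivative_chain_real:
  fixes f :: "real \<Rightarrow> 'a::real_normed_algebra_1"
  assumes "(y has_real_derivative d) (at z)" "(f has_vector_derivative D) (at (y z))"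
  shows "((\<lambda>z. f (y z)) has_vector_derivative of_real d * D) (at z)"
  using vector_diff_chain_at[of y d z f D] assms
  by (simp add: has_real_derivative_iff_has_vector_derivative o_def scaleR_conv_of_real)

lemma continuous_on_if_has_vector_derivative:
  assumes "\<And>u. (f has_vector_derivative f' u) (at u)"
  shows "continuous_on S f"
  using has_vector_derivative_continuous[OF assms] by (blast intro: continuous_at_imp_continuous_on)

lemma has_vector_derivative_uminus_arg:
  assumes "(x has_vector_derivative D) (at (- t))"
  shows "((\<lambda>t. x (- t)) has_vector_derivative - D) (at t)"
proof -
  have "(uminus has_vector_derivative - 1) (at t)"
    using has_vector_derivative_minus[OF has_vector_derivative_id[of "at t"]] by simp
  from vector_diff_chain_at[OF this assms] show ?thesis
    by (simp add: o_def)
qed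

lemma has_vector_derivative_bound:
  fixes f :: "real \<Rightarrow> 'a::real_normed_vector"
  assumes "convex S" and "\<And>u. u \<in> S \<Longrightarrow> (f has_vector_derivative f' u) (at u)"
    and "\<And>u. u \<in> S \<Longrightarrow> norm (f' u) \<le> B" and "x \<in> S" "y \<in> S"
  shows "norm (f x - f y) \<le> B * \<bar>x - y\<bar>"
proof -
  have "norm (f x - f y) \<le> B * norm (x - y)"
  proof (rule differentiable_bound[OF \<open>convex S\<close>])
    fix u assume u: "u \<in> S"
    show "(f has_derivative (\<lambda>h. h *\<^sub>R f' u)) (at u within S)"
      using assms(2)[OF u] by (simp add: has_vector_derivative_def has_derivative_at_withinI)
    show "onorm (\<lambda>h. h *\<^sub>R f' u) \<le> B"
      using assms(3)[OF u] by (intro onorm_le) (simp add: mult.commute[of B] mult_left_mono)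
  qed fact+
  then show ?thesis by simp
qed

lemma gronwall_zero_backwards:
  fixes x :: "real \<Rightarrow> 'a::real_inner"
  assumes "a \<le> b"
    and x: "\<And>t. t \<in> {a..b} \<Longrightarrow> (x has_vector_derivative x' t) (at t)"
    and bound: "\<And>t. t \<in> {a..b} \<Longrightarrow> norm (x' t) \<le> L * norm (x t)"
    and "x b = 0"
  shows "x a = 0"
proof -
  define E where "E = (\<lambda>t. (x t \<bullet> x t) * exp (2 * L * t))"
  have "E a \<le> E b"
  proof (rule DERIV_nonneg_imp_nondecreasing[OF \<open>a \<le> b\<close>])
    fix t assume "a \<le> t" "t \<le> b"
    then have t: "t \<in> {a..b}" by simp
    have "((\<lambda>t. x t \<bullet> x t) has_real_derivative 2 * (x t \<bullet> x' t)) (at t)"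
      using bounded_bilinear.has_vector_derivative[OF bounded_bilinear_inner x[OF t] x[OF t]]
      by (simp add: has_real_derivative_iff_has_vector_derivative inner_commute)
    then have "(E has_real_derivative 2 * (x t \<bullet> x' t + L * (x t \<bullet> x t)) * exp (2 * L * t)) (at t)"
      unfolding E_def by (auto intro!: derivative_eq_intros simp: algebra_simps)
    moreover have "- (x t \<bullet> x' t) \<le> L * (x t \<bullet> x t)"
    proof -
      have "- (x t \<bullet> x' t) \<le> norm (x t) * norm (x' t)"
        using norm_cauchy_schwarz[of "- x t" "x' t"] by simp
      also have "\<dots> \<le> norm (x t) * (L * norm (x t))"
        using bound[OF t] by (intro mult_left_mono) auto
      finally show ?thesis
        by (simp add: dot_square_norm power2_eq_square mult_ac)
    qed
    ultimately show "\<exists>D. (E has_real_derivative D) (at t) \<and> 0 \<le> D"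
      by (intro exI conjI mult_nonneg_nonneg) auto
  qed
  with \<open>x b = 0\<close> have "x a \<bullet> x a \<le> 0"
    by (simp add: E_def mult_le_0_iff)
  then show ?thesis
    by (simp add: dot_square_norm)
qed

lemma gronwall_zero:
  fixes x :: "real \<Rightarrow> 'a::real_inner"
  assumes x: "\<And>t. t \<in> {a..b} \<Longrightarrow> (x has_vector_derivative x' t) (at t)"
    and bound: "\<And>t. t \<in> {a..b} \<Longrightarrow> norm (x' t) \<le> L * norm (x t)"
    and "t\<^sub>0 \<in> {a..b}" "x t\<^sub>0 = 0" "t \<in> {a..b}"
  shows "x t = 0"
proof (cases "t \<le> t\<^sub>0")
  case True
  show ?thesis
    by (rule gronwall_zero_backwards[OF True, where x' = x' and L = L]) (use assms in auto)
next
  case False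
  then have "- t \<le> - t\<^sub>0" by simp
  then have "x (- (- t)) = 0"
    by (rule gronwall_zero_backwards[where x = "\<lambda>u. x (- u)" and x' = "\<lambda>u. - x' (- u)" and L = L])
       (use assms in \<open>auto intro!: has_vector_derivative_uminus_arg\<close>)
  then show ?thesis by simp
qed

definition ode2_solution_on ::
    "real set \<Rightarrow> (real \<Rightarrow> complex) \<Rightarrow> (real \<Rightarrow> complex) \<Rightarrow> (real \<Rightarrow> complex) \<Rightarrow> bool" where
  "ode2_solution_on S q f f' \<longleftrightarrow>
    (\<forall>z\<in>S. (f has_vector_derivative f' z) (at z)) \<and>
    (\<forall>z\<in>S. (f' has_vector_derivative q z * f z) (at z))"

lemma ode2_solution_onD:
  assumes "ode2_solution_on S q f f'" "z \<in> S"
  shows "(f has_vector_derivative f' z) (at z)" "(f' has_vector_derivative q z * f z) (at z)"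
  using assms by (auto simp: ode2_solution_on_def)

lemma ode2_solution_on_cong:
  assumes sol: "ode2_solution_on S q f f'" and "open S" and eq: "\<And>z. z \<in> S \<Longrightarrow> f z = h z"
  shows "ode2_solution_on S q h f'"
  unfolding ode2_solution_on_def
proof (intro conjI ballI)
  fix z assume z: "z \<in> S"
  show "(h has_vector_derivative f' z) (at z)"
    using ode2_solution_onD(1)[OF sol z] \<open>open S\<close> z eq
    by (rule has_vector_derivative_transform_within_open)
  show "(f' has_vector_derivative q z * h z) (at z)"
    using ode2_solution_onD(2)[OF sol z] by (simp add: eq[OF z])
qed

lemma ode2_solution_on_diff_mult:
  assumes "ode2_solution_on S q f f'" "ode2_solution_on S q g g'"
  shows "ode2_solution_on S q (\<lambda>z. f z - c * g z) (\<lambda>z. f' z - c * g' z)"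
  unfolding ode2_solution_on_def
proof (intro conjI ballI)
  fix z assume z: "z \<in> S"
  note D = ode2_solution_onD[OF assms(1) z] ode2_solution_onD[OF assms(2) z]
  show "((\<lambda>z. f z - c * g z) has_vector_derivative f' z - c * g' z) (at z)"
    by (intro derivative_intros D)
  show "((\<lambda>z. f' z - c * g' z) has_vector_derivative q z * (f z - c * g z)) (at z)"
    by (rule has_vector_derivative_eq_rhs, (rule derivative_intros D)+) (simp add: algebra_simps)
qed

lemma ode2_solution_zero:
  assumes sol: "ode2_solution_on S q f f'" and S: "is_interval S" and q: "continuous_on S q"
    and z: "z\<^sub>0 \<in> S" "f z\<^sub>0 = 0" "f' z\<^sub>0 = 0" "z \<in> S"
  shows "f z = 0"
proof -
  let ?I = "{min z\<^sub>0 z..max z\<^sub>0 z}"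
  have I: "?I \<subseteq> S"
  proof
    fix t assume t: "t \<in> ?I"
    show "t \<in> S"
      by (rule mem_is_interval_1_I[OF S, of "min z\<^sub>0 z" "max z\<^sub>0 z"])
        (use z t in \<open>auto simp: min_def max_def\<close>)
  qed
  have "bounded (q ` ?I)"
    using q I by (intro compact_imp_bounded compact_continuous_image)
      (auto intro: continuous_on_subset)
  then obtain M where M: "\<And>t. t \<in> ?I \<Longrightarrow> norm (q t) \<le> M"
    unfolding bounded_iff by (metis imageI)
  have "(f z, f' z) = 0"
  proof (rule gronwall_zero[where x = "\<lambda>t. (f t, f' t)" and x' = "\<lambda>t. (f' t, q t * f t)"
    and t\<^sub>0 = z\<^sub>0])
    fix t assume t: "t \<in> ?I"
    then show "((\<lambda>t. (f t, f' t)) has_vector_derivative (f' t, q t * f t)) (at t)"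
      using I by (intro has_vector_derivative_Pair ode2_solution_onD[OF sol]) auto
    have "norm (f' t, q t * f t) \<le> norm (f' t) + norm (q t * f t)"
      by (rule norm_Pair_le)
    also have "\<dots> \<le> norm (f t, f' t) + M * norm (f t, f' t)"
      unfolding norm_mult using order_trans[OF norm_ge_zero M[OF t]]
      by (intro add_mono mult_mono M[OF t] norm_fst_le norm_snd_le) auto
    finally show "norm (f' t, q t * f t) \<le> (1 + M) * norm (f t, f' t)"
      by (simp add: algebra_simps)
  qed (use z in \<open>auto simp: zero_prod_def\<close>)
  then show ?thesis by (simp add: zero_prod_def)
qed

definition wronskian :: "(real \<Rightarrow> complex) \<Rightarrow> (real \<Rightarrow> complex) \<Rightarrow>
    (real \<Rightarrow> complex) \<Rightarrow> (real \<Rightarrow> complex) \<Rightarrow> real \<Rightarrow> complex" where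
  "wronskian f f' g g' z = f z * g' z - g z * f' z"

lemma wronskian_constant:
  assumes "ode2_solution_on S q f f'" "ode2_solution_on S q g g'" "convex S"
  obtains c where "\<And>z. z \<in> S \<Longrightarrow> wronskian f f' g g' z = c"
proof -
  have "(wronskian f f' g g' has_vector_derivative 0) (at z)" if "z \<in> S" for z
    unfolding wronskian_def[abs_def]
    by (rule has_vector_derivative_eq_rhs,
        (rule has_vector_derivative_diff has_vector_derivative_mult
          ode2_solution_onD[OF assms(1) that] ode2_solution_onD[OF assms(2) that])+)
       (simp add: algebra_simps)
  then show thesis
    using has_vector_derivative_zero_constant[OF \<open>convex S\<close>] that
    by (metis has_vector_derivative_at_within)
qed

lemma ode2_solutions_proportional:
  assumes sol: "ode2_solution_on S q f f'" "ode2_solution_on S q g g'"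
    and S: "is_interval S" and q: "continuous_on S q"
    and z\<^sub>0: "z\<^sub>0 \<in> S" "f z\<^sub>0 \<noteq> 0" "wronskian f f' g g' z\<^sub>0 = 0" and "z \<in> S"
  shows "g z = g z\<^sub>0 / f z\<^sub>0 * f z"
proof -
  have "g z - g z\<^sub>0 / f z\<^sub>0 * f z = 0"
    by (rule ode2_solution_zero[OF ode2_solution_on_diff_mult[OF sol(2,1)] S q \<open>z\<^sub>0 \<in> S\<close>])
       (use z\<^sub>0 \<open>z \<in> S\<close> in \<open>auto simp: wronskian_def field_simps\<close>)
  then show ?thesis by simp
qed

lemma derivative_tendsto_0_at_top:
  fixes f :: "real \<Rightarrow> 'a::real_normed_vector"
  assumes f: "eventually (\<lambda>z. (f has_vector_derivative f' z) (at z)) at_top"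
    and f': "eventually (\<lambda>z. (f' has_vector_derivative f'' z) (at z)) at_top"
    and lim: "(f \<longlongrightarrow> 0) at_top" "(f'' \<longlongrightarrow> 0) at_top"
  shows "(f' \<longlongrightarrow> 0) at_top"
proof (rule tendstoI)
  fix e :: real assume e: "e > 0"
  have "eventually (\<lambda>z. norm (f z) < e / 4) at_top" "eventually (\<lambda>z. norm (f'' z) < e / 4) at_top"
    using tendstoD[OF lim(1), of "e / 4"] tendstoD[OF lim(2), of "e / 4"] e by auto
  with f f' have "eventually (\<lambda>z. (f has_vector_derivative f' z) (at z) \<and>
      (f' has_vector_derivative f'' z) (at z) \<and> norm (f z) < e / 4 \<and> norm (f'' z) < e / 4) at_top"
    by eventually_elim auto
  then obtain N where N: "\<And>z. z \<ge> N \<Longrightarrow> (f has_vector_derivative f' z) (at z)"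
      "\<And>z. z \<ge> N \<Longrightarrow> (f' has_vector_derivative f'' z) (at z)"
      "\<And>z. z \<ge> N \<Longrightarrow> norm (f z) < e / 4" "\<And>z. z \<ge> N \<Longrightarrow> norm (f'' z) < e / 4"
    unfolding eventually_at_top_linorder by metis
  have "norm (f' z) < e" if z: "z \<ge> N" for z
  proof -
    have "norm (f' t - f' z) \<le> e / 4" if t: "t \<in> {z..z+1}" for t
    proof -
      have "norm (f' t - f' z) \<le> e / 4 * \<bar>t - z\<bar>"
        using t z N(2,4)
        by (intro has_vector_derivative_bound[of "{z..z+1}" f' f'']) (auto simp: less_imp_le)
      also have "\<dots> \<le> e / 4 * 1"
        using t e by (intro mult_left_mono) auto
      finally show ?thesis by simp
    qed
    then have taylor: "norm (f (z + 1) - f z - (z + 1 - z) *\<^sub>R f' z) \<le> norm (z + 1 - z) * (e / 4)"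
      using z N(1) by (intro vector_differentiable_bound_linearization[where S = "{z..z+1}"])
        (auto intro: has_vector_derivative_at_within simp: closed_segment_eq_real_ivl)
    have "norm (f' z) \<le> norm (f (z + 1)) + norm (f z) + norm (f (z + 1) - f z - f' z)"
      using norm_triangle_ineq4[of "f (z + 1) - f z" "f (z + 1) - f z - f' z"]
        norm_triangle_ineq4[of "f (z + 1)" "f z"] by simp
    with taylor N(3)[of z] N(3)[of "z + 1"] z e show ?thesis by simp
  qed
  then show "eventually (\<lambda>z. dist (f' z) 0 < e) at_top"
    by (auto simp: eventually_at_top_linorder)
qed

lemma tendsto_mult_zero_of_ratio:
  fixes f \<phi> q :: "'a \<Rightarrow> complex"
  assumes ratio: "((\<lambda>z. f z / \<phi> z) \<longlongrightarrow> l) F" and "l \<noteq> 0" and q: "((\<lambda>z. q z * \<phi> z) \<longlongrightarrow> 0) F"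
  shows "((\<lambda>z. q z * f z) \<longlongrightarrow> 0) F"
proof (rule Lim_transform_eventually)
  show "((\<lambda>z. q z * \<phi> z * (f z / \<phi> z)) \<longlongrightarrow> 0) F"
    using tendsto_mult[OF q ratio] by simp
  show "eventually (\<lambda>z. q z * \<phi> z * (f z / \<phi> z) = q z * f z) F"
    using tendsto_imp_eventually_ne[OF ratio \<open>l \<noteq> 0\<close>] by eventually_elim auto
qed

lemma recessive_wronskian_tendsto_0:
  assumes sol: "ode2_solution_on S q f f'" "ode2_solution_on S q g g'"
    and S: "eventually (\<lambda>z. z \<in> S) at_top"
    and ratio: "((\<lambda>z. f z / \<phi> z) \<longlongrightarrow> 1) at_top" "((\<lambda>z. g z / \<phi> z) \<longlongrightarrow> 1) at_top"
    and \<phi>: "(\<phi> \<longlongrightarrow> 0) at_top" "((\<lambda>z. q z * \<phi> z) \<longlongrightarrow> 0) at_top"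
  shows "(wronskian f f' g g' \<longlongrightarrow> 0) at_top"
proof -
  have "(h \<longlongrightarrow> 0) at_top \<and> (h' \<longlongrightarrow> 0) at_top"
    if h: "ode2_solution_on S q h h'" and ratio: "((\<lambda>z. h z / \<phi> z) \<longlongrightarrow> 1) at_top" for h h'
  proof
    have "eventually (\<lambda>z. (h has_vector_derivative h' z) (at z)) at_top"
      "eventually (\<lambda>z. (h' has_vector_derivative q z * h z) (at z)) at_top"
      using S by (auto elim!: eventually_mono intro: ode2_solution_onD[OF h])
    moreover show "(h \<longlongrightarrow> 0) at_top"
      using tendsto_mult_zero_of_ratio[OF ratio, of "\<lambda>_. 1"] \<phi>(1) by simp
    moreover have "((\<lambda>z. q z * h z) \<longlongrightarrow> 0) at_top"
      using tendsto_mult_zero_of_ratio[OF ratio _ \<phi>(2)] by simp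
    ultimately show "(h' \<longlongrightarrow> 0) at_top"
      by (rule derivative_tendsto_0_at_top)
  qed
  from this[OF sol(1) ratio(1)] this[OF sol(2) ratio(2)] show ?thesis
    unfolding wronskian_def[abs_def] by (auto intro!: tendsto_eq_intros)
qed

lemma recessive_solution_unique:
  assumes sol: "ode2_solution_on S q f f'" "ode2_solution_on S q g g'"
    and S: "is_interval S" "eventually (\<lambda>z. z \<in> S) at_top" and q: "continuous_on S q"
    and ratio: "((\<lambda>z. f z / \<phi> z) \<longlongrightarrow> 1) at_top" "((\<lambda>z. g z / \<phi> z) \<longlongrightarrow> 1) at_top"
    and \<phi>: "(\<phi> \<longlongrightarrow> 0) at_top" "((\<lambda>z. q z * \<phi> z) \<longlongrightarrow> 0) at_top"
    and "z \<in> S"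
  shows "f z = g z"
proof -
  obtain c where c: "\<And>z. z \<in> S \<Longrightarrow> wronskian f f' g g' z = c"
    using wronskian_constant[OF sol] S(1) is_interval_convex by blast
  then have "((\<lambda>_. c) \<longlongrightarrow> 0) (at_top :: real filter)"
    using Lim_transform_eventually[OF recessive_wronskian_tendsto_0[OF sol S(2) ratio \<phi>]] S(2)
    by (simp add: eventually_mono)
  then have wronskian_eq_0: "wronskian f f' g g' z = 0" if "z \<in> S" for z
    using c that by (simp add: tendsto_const_iff)
  have "eventually (\<lambda>z. z \<in> S \<and> f z / \<phi> z \<noteq> 0) at_top"
    using tendsto_imp_eventually_ne[OF ratio(1) one_neq_zero] by (intro eventually_conj S(2))
  then obtain z\<^sub>0 where z\<^sub>0: "z\<^sub>0 \<in> S" "f z\<^sub>0 \<noteq> 0"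
    using eventually_happens by fastforce
  define r where "r = g z\<^sub>0 / f z\<^sub>0"
  have g_eq: "g z = r * f z" if "z \<in> S" for z
    unfolding r_def
    by (rule ode2_solutions_proportional[OF sol S(1) q z\<^sub>0 wronskian_eq_0[OF z\<^sub>0(1)] that])
  have "((\<lambda>z. r * (f z / \<phi> z)) \<longlongrightarrow> 1) at_top"
    using S(2) by (intro Lim_transform_eventually[OF ratio(2)])
      (auto elim!: eventually_mono simp: g_eq)
  moreover have "((\<lambda>z. r * (f z / \<phi> z)) \<longlongrightarrow> r * 1) at_top"
    by (intro tendsto_mult tendsto_const ratio(1))
  ultimately have "r = 1"
    using tendsto_unique[of "at_top :: real filter"] by fastforce
  then show ?thesis using g_eq \<open>z \<in> S\<close> by simp
qed

lemma ode2_solution_on_liouville: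
  assumes f: "\<And>z. z \<in> S \<Longrightarrow> (f has_vector_derivative f' z) (at z)"
    and f': "\<And>z. z \<in> S \<Longrightarrow> (f' has_vector_derivative r z * f z - 2 * b z * f' z) (at z)"
    and a: "\<And>z. z \<in> S \<Longrightarrow> (a has_vector_derivative b z * a z) (at z)"
    and b: "\<And>z. z \<in> S \<Longrightarrow> (b has_vector_derivative b' z) (at z)"
  shows "ode2_solution_on S (\<lambda>z. r z + (b z)\<^sup>2 + b' z)
    (\<lambda>z. a z * f z) (\<lambda>z. a z * (b z * f z + f' z))"
  unfolding ode2_solution_on_def
proof (intro conjI ballI)
  fix z assume z: "z \<in> S"
  show "((\<lambda>z. a z * f z) has_vector_derivative a z * (b z * f z + f' z)) (at z)"
    by (rule has_vector_derivative_eq_rhs, (rule has_vector_derivative_mult f a z)+)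
       (simp add: algebra_simps)
  show "((\<lambda>z. a z * (b z * f z + f' z)) has_vector_derivative
      (r z + (b z)\<^sup>2 + b' z) * (a z * f z)) (at z)"
    by (rule has_vector_derivative_eq_rhs,
        (rule has_vector_derivative_mult has_vector_derivative_add f f' a b z)+)
       (simp add: algebra_simps power2_eq_square)
qed

section \<open>Integrals over the real line\<close>

lemma has_vector_derivative_iff_quotient:
  fixes f :: "real \<Rightarrow> 'a::real_normed_vector"
  shows "(f has_vector_derivative D) (at y) \<longleftrightarrow> ((\<lambda>u. (f u - f y) /\<^sub>R (u - y)) \<longlongrightarrow> D) (at y)"
proof -
  have "norm (f u - f y - (u - y) *\<^sub>R D) / norm (u - y) = norm ((f u - f y) /\<^sub>R (u - y) - D)"
    if "u \<noteq> y" for u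
  proof -
    have "(f u - f y) /\<^sub>R (u - y) - D = (f u - f y - (u - y) *\<^sub>R D) /\<^sub>R (u - y)"
      using that by (simp add: scaleR_diff_right)
    then show ?thesis by (simp add: divide_inverse mult.commute abs_inverse)
  qed
  then have "((\<lambda>u. norm (f u - f y - (u - y) *\<^sub>R D) / norm (u - y)) \<longlongrightarrow> 0) (at y) \<longleftrightarrow>
      ((\<lambda>u. norm ((f u - f y) /\<^sub>R (u - y) - D)) \<longlongrightarrow> 0) (at y)"
    by (intro tendsto_cong) (auto simp: eventually_at_filter)
  then show ?thesis
    by (simp add: has_vector_derivative_def has_derivative_iff_norm bounded_linear_scaleR_left
        tendsto_norm_zero_iff Lim_null[symmetric])
qed

lemma integral_dominated_convergence_within:
  fixes f :: "'c::first_countable_topology \<Rightarrow> 'a \<Rightarrow> 'b::{banach, second_countable_topology}"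
  assumes meas: "g \<in> borel_measurable M" "\<And>u. u \<in> S - {y} \<Longrightarrow> f u \<in> borel_measurable M"
    and w: "integrable M w"
    and lim: "\<And>s. s \<in> space M \<Longrightarrow> ((\<lambda>u. f u s) \<longlongrightarrow> g s) (at y within S)"
    and bound: "\<And>u s. u \<in> S - {y} \<Longrightarrow> s \<in> space M \<Longrightarrow> norm (f u s) \<le> w s"
  shows "((\<lambda>u. \<integral>s. f u s \<partial>M) \<longlongrightarrow> (\<integral>s. g s \<partial>M)) (at y within S)"
  unfolding tendsto_at_iff_sequentially o_def
proof (intro allI impI)
  fix X :: "nat \<Rightarrow> 'c" assume X: "\<forall>i. X i \<in> S - {y}" "X \<longlonglongrightarrow> y"
  show "(\<lambda>i. \<integral>s. f (X i) s \<partial>M) \<longlonglongrightarrow> (\<integral>s. g s \<partial>M)"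
  proof (rule integral_dominated_convergence[OF meas(1) _ w])
    show "AE s in M. (\<lambda>i. f (X i) s) \<longlonglongrightarrow> g s"
      using lim X unfolding tendsto_at_iff_sequentially o_def by (intro AE_I2) blast
  qed (use X(1) meas(2) bound in auto)
qed

lemma has_vector_derivative_integral_dominated:
  fixes f f' :: "real \<Rightarrow> 'a \<Rightarrow> 'b::{banach, second_countable_topology}"
  assumes y: "y \<in> {a<..<b}"
    and deriv: "\<And>u s. u \<in> {a<..<b} \<Longrightarrow> s \<in> space M \<Longrightarrow>
      ((\<lambda>u. f u s) has_vector_derivative f' u s) (at u)"
    and int: "\<And>u. u \<in> {a<..<b} \<Longrightarrow> integrable M (f u)"
    and bound: "\<And>u s. u \<in> {a<..<b} \<Longrightarrow> s \<in> space M \<Longrightarrow> norm (f' u s) \<le> G s"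
    and G: "integrable M G" and meas: "f' y \<in> borel_measurable M"
  shows "((\<lambda>u. \<integral>s. f u s \<partial>M) has_vector_derivative (\<integral>s. f' y s \<partial>M)) (at y)"
proof -
  define Q where "Q = (\<lambda>u s. (f u s - f y s) /\<^sub>R (u - y))"
  have at_y: "at y within {a<..<b} = at y"
    using y by (intro at_within_open) auto
  have "((\<lambda>u. \<integral>s. Q u s \<partial>M) \<longlongrightarrow> (\<integral>s. f' y s \<partial>M)) (at y within {a<..<b})"
  proof (rule integral_dominated_convergence_within[OF meas _ G])
    fix u assume u: "u \<in> {a<..<b} - {y}"
    then show "Q u \<in> borel_measurable M"
      unfolding Q_def using int[of u] int[OF y] by auto
    fix s assume s: "s \<in> space M"
    have "norm (f u s - f y s) \<le> G s * \<bar>u - y\<bar>"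
      using deriv[OF _ s] bound[OF _ s] u y
      by (intro has_vector_derivative_bound[of "{a<..<b}" _ "\<lambda>u. f' u s"]) auto
    then show "norm (Q u s) \<le> G s"
      using u by (auto simp: Q_def divide_simps norm_divide)
  next
    fix s assume "s \<in> space M"
    with deriv[OF y] show "((\<lambda>u. Q u s) \<longlongrightarrow> f' y s) (at y within {a<..<b})"
      by (simp add: Q_def at_y has_vector_derivative_iff_quotient)
  qed
  moreover have "eventually (\<lambda>u. (\<integral>s. Q u s \<partial>M) =
      ((\<integral>s. f u s \<partial>M) - (\<integral>s. f y s \<partial>M)) /\<^sub>R (u - y)) (at y within {a<..<b})"
    using int y by (auto simp: eventually_at_filter Q_def)
  ultimately show ?thesis
    unfolding has_vector_derivative_iff_quotient at_y by (rule Lim_transform_eventually)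
qed

lemma integral_FTC_UNIV:
  fixes F f :: "real \<Rightarrow> 'a::euclidean_space"
  assumes F: "\<And>s. (F has_vector_derivative f s) (at s)"
    and "continuous_on UNIV f" "integrable lborel f"
    and lim: "(F \<longlongrightarrow> A) at_bot" "(F \<longlongrightarrow> B) at_top"
  shows "integral\<^sup>L lborel f = B - A"
proof -
  have "(LBINT s=-\<infinity>..\<infinity>. f s) = B - A"
  proof (rule interval_integral_FTC_integrable)
    show "isCont f s" for s
      using assms(2) by (simp add: continuous_on_eq_continuous_at)
    show "set_integrable lborel (einterval (-\<infinity>) \<infinity>) f"
      using assms(3) by (simp add: set_integrable_def)
    show "((F \<circ> real_of_ereal) \<longlongrightarrow> A) (at_right (- \<infinity>))" "((F \<circ> real_of_ereal) \<longlongrightarrow> B) (at_left \<infinity>)"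
      using lim by (simp_all add: ereal_tendsto_simps)
  qed (simp_all add: F)
  then show ?thesis
    by (simp add: interval_lebesgue_integral_def set_lebesgue_integral_def)
qed

lemma integral_exp_mult_second_derivative:
  fixes G G' G'' :: "real \<Rightarrow> complex" and \<nu> :: complex
  assumes G: "\<And>s. (G has_vector_derivative G' s) (at s)"
      "\<And>s. (G' has_vector_derivative G'' s) (at s)"
    and cont: "continuous_on UNIV G''"
    and int: "integrable lborel (\<lambda>s. exp (\<nu> * of_real s) * G s)"
      "integrable lborel (\<lambda>s. exp (\<nu> * of_real s) * G'' s)"
    and lim: "\<And>F. F \<in> {at_bot, at_top} \<Longrightarrow> ((\<lambda>s. exp (\<nu> * of_real s) * G s) \<longlongrightarrow> 0) F"
      "\<And>F. F \<in> {at_bot, at_top} \<Longrightarrow> ((\<lambda>s. exp (\<nu> * of_real s) * G' s) \<longlongrightarrow> 0) F"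
  shows "(\<integral>s. exp (\<nu> * of_real s) * G'' s \<partial>lborel) = \<nu>\<^sup>2 * (\<integral>s. exp (\<nu> * of_real s) * G s \<partial>lborel)"
proof -
  define H where "H = (\<lambda>s. exp (\<nu> * of_real s) * G' s - \<nu> * (exp (\<nu> * of_real s) * G s))"
  define h where "h = (\<lambda>s. exp (\<nu> * of_real s) * G'' s - \<nu>\<^sup>2 * (exp (\<nu> * of_real s) * G s))"
  have exp: "((\<lambda>s. exp (\<nu> * of_real s)) has_vector_derivative \<nu> * exp (\<nu> * of_real s)) (at s)" for s
    by (rule has_vector_derivative_real_field) (auto intro!: derivative_eq_intros)
  have H: "(H has_vector_derivative h s) (at s)" for s
    unfolding H_def
    by (rule has_vector_derivative_eq_rhs,
        (rule has_vector_derivative_diff has_vector_derivative_mult_right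
          has_vector_derivative_mult exp G)+)
       (simp add: h_def algebra_simps power2_eq_square)
  have lim_H: "(H \<longlongrightarrow> 0) F" if "F \<in> {at_bot, at_top}" for F
    unfolding H_def
    using tendsto_diff[OF lim(2)[OF that] tendsto_mult_right_zero[OF lim(1)[OF that]]] by simp
  have "continuous_on UNIV G"
    by (rule continuous_on_if_has_vector_derivative[OF G(1)])
  then have "continuous_on UNIV h"
    unfolding h_def by (intro continuous_intros cont)
  moreover have "integrable lborel h"
    unfolding h_def using int by simp
  ultimately have "integral\<^sup>L lborel h = 0 - 0"
    using lim_H by (intro integral_FTC_UNIV[OF H]) auto
  then show ?thesis
    unfolding h_def using int by simp
qed

lemma integrable_restrict_space_eq_set:
  fixes f :: "'a \<Rightarrow> 'b::{banach, second_countable_topology}"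
  assumes "A \<in> sets M"
  shows "integrable (restrict_space M A) f \<longleftrightarrow> set_integrable M A f"
  using assms by (simp add: integrable_restrict_space set_integrable_def)

lemma integral_restrict_space_eq_set:
  fixes f :: "'a \<Rightarrow> 'b::{banach, second_countable_topology}"
  assumes "A \<in> sets M"
  shows "integral\<^sup>L (restrict_space M A) f = (LINT x:A|M. f x)"
  using assms by (simp add: integral_restrict_space set_lebesgue_integral_def)

lemma set_integral_Ioi_scale:
  fixes f :: "real \<Rightarrow> 'a::{banach, second_countable_topology}"
  assumes "c > 0"
  shows "(LINT t:{0<..}|lborel. f t) = c *\<^sub>R (LINT t:{0<..}|lborel. f (c * t))"
  unfolding set_lebesgue_integral_def
  using assms by (subst lborel_integral_real_affine[where c = c and t = 0])
    (auto simp: indicator_def zero_less_mult_iff)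

lemma integrable_exp_abs_minus_square:
  fixes L \<delta> :: real
  assumes "\<delta> > 0"
  shows "integrable lborel (\<lambda>s. exp (L * \<bar>s\<bar> - \<delta> * s\<^sup>2))"
proof (rule Bochner_Integration.integrable_bound)
  let ?\<sigma> = "1 / sqrt \<delta>"
  let ?g = "\<lambda>s. exp (L\<^sup>2 / (2 * \<delta>)) * sqrt (2 * pi * ?\<sigma>\<^sup>2) * normal_density 0 ?\<sigma> s"
  show "integrable lborel ?g"
    using assms by (intro integrable_mult_right integrable_normal_density) simp
  show "AE s in lborel. norm (exp (L * \<bar>s\<bar> - \<delta> * s\<^sup>2)) \<le> norm (?g s)"
  proof (intro AE_I2)
    fix s :: real
    have "0 \<le> (\<delta> * \<bar>s\<bar> - L)\<^sup>2 / (2 * \<delta>)" using assms by simp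
    then have "L * \<bar>s\<bar> - \<delta> * s\<^sup>2 \<le> L\<^sup>2 / (2 * \<delta>) + - (\<delta> * s\<^sup>2 / 2)"
      using assms by (simp add: power2_eq_square field_simps)
    then have "exp (L * \<bar>s\<bar> - \<delta> * s\<^sup>2) \<le> exp (L\<^sup>2 / (2 * \<delta>)) * exp (- (\<delta> * s\<^sup>2 / 2))"
      by (simp only: exp_add[symmetric] exp_le_cancel_iff)
    also have "\<dots> = ?g s"
      using assms by (simp add: normal_density_def power_divide real_sqrt_divide field_simps)
    finally show "norm (exp (L * \<bar>s\<bar> - \<delta> * s\<^sup>2)) \<le> norm (?g s)"
      by simp
  qed
qed auto

lemma integral_exp_minus_square:
  assumes "\<sigma> > 0"
  shows "(\<integral>t. exp (- t\<^sup>2 / (2 * \<sigma>\<^sup>2)) \<partial>lborel) = sqrt (2 * pi * \<sigma>\<^sup>2)"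
proof -
  have "(\<integral>t. exp (- t\<^sup>2 / (2 * \<sigma>\<^sup>2)) \<partial>lborel) =
      (\<integral>t. sqrt (2 * pi * \<sigma>\<^sup>2) * normal_density 0 \<sigma> t \<partial>lborel)"
    using assms by (intro Bochner_Integration.integral_cong refl) (simp add: normal_density_def)
  then show ?thesis using assms by simp
qed

lemma integral_even_eq_twice:
  fixes f :: "real \<Rightarrow> 'a::{banach, second_countable_topology}"
  assumes f: "integrable lborel f" and even: "\<And>s. f (- s) = f s"
  shows "integral\<^sup>L lborel f = 2 *\<^sub>R (LINT s:{0..}|lborel. f s)"
proof -
  have int: "set_integrable lborel {0..} f" "set_integrable lborel {..0} f"
    using f by (simp_all add: set_integrable_def integrable_mult_indicator)
  have "{0..} \<union> {..0} = (UNIV :: real set)" by auto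
  then have "integral\<^sup>L lborel f = (LINT s:{0..} \<union> {..0}|lborel. f s)"
    by (simp add: set_lebesgue_integral_def)
  also have "\<dots> = (LINT s:{0..}|lborel. f s) + (LINT s:{..0}|lborel. f s)"
  proof (rule set_integral_Un_AE[OF _ _ _ int])
    show "AE s::real in lborel. \<not> (s \<in> {0..} \<and> s \<in> {..0})"
      using AE_lborel_singleton[of 0] by eventually_elim auto
  qed auto
  also have "(LINT s:{..0}|lborel. f s) = (LINT s:{0..}|lborel. f s)"
    by (subst set_integral_reflect) (simp add: even atLeast_def)
  finally show ?thesis by (simp add: scaleR_2)
qed

definition gaussian_decay :: "(real \<Rightarrow> 'a::real_normed_vector) \<Rightarrow> bool" where
  "gaussian_decay \<Phi> \<longleftrightarrow> (\<exists>C. \<exists>\<delta>>0. \<forall>u\<ge>0. norm (\<Phi> u) \<le> C * exp (- \<delta> * u\<^sup>2))"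

lemma gaussian_decayE:
  assumes "gaussian_decay \<Phi>"
  obtains C \<delta> where "C \<ge> 0" "\<delta> > 0" "\<And>u. u \<ge> 0 \<Longrightarrow> norm (\<Phi> u) \<le> C * exp (- \<delta> * u\<^sup>2)"
proof -
  from assms obtain C \<delta> where \<Phi>: "\<delta> > 0" "\<And>u. u \<ge> 0 \<Longrightarrow> norm (\<Phi> u) \<le> C * exp (- \<delta> * u\<^sup>2)"
    by (auto simp: gaussian_decay_def)
  moreover have "C \<ge> 0"
    using order_trans[OF norm_ge_zero \<Phi>(2)[of 0]] by simp
  ultimately show thesis by (rule that[rotated])
qed

lemma gaussian_decay_uminus: "gaussian_decay (\<lambda>u. - \<Phi> u) \<longleftrightarrow> gaussian_decay \<Phi>"
  by (simp add: gaussian_decay_def)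

lemma bounded_image_atLeast_if_tendsto:
  fixes h :: "real \<Rightarrow> 'a::real_normed_vector"
  assumes "continuous_on {a..} h" "(h \<longlongrightarrow> l) at_top"
  shows "bounded (h ` {a..})"
proof -
  obtain N where N: "\<And>u. u \<ge> N \<Longrightarrow> dist (h u) l < 1"
    using tendstoD[OF assms(2) zero_less_one] by (auto simp: eventually_at_top_linorder)
  have "bounded (h ` {a..N})"
    using assms(1) by (intro compact_imp_bounded compact_continuous_image)
      (auto intro: continuous_on_subset)
  moreover have "bounded (h ` {N..})"
    using N by (intro bounded_subset[OF bounded_ball[of l 1]]) (auto simp: dist_commute)
  ultimately have "bounded (h ` ({a..N} \<union> {N..}))" by (simp add: image_Un)
  then show ?thesis by (rule bounded_subset) (intro image_mono, auto)
qed

lemma square_le_sinh_square: "x\<^sup>2 \<le> (sinh (x::real))\<^sup>2"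
  using real_le_abs_sinh[of x] by (simp add: sinh_field_def exp_minus flip: abs_le_square_iff)

lemma abs_sinh_le_cosh: "\<bar>sinh (x::real)\<bar> \<le> cosh x"
  by (simp add: sinh_def cosh_def abs_le_iff)

lemma cosh_le_exp_abs: "cosh (x::real) \<le> exp \<bar>x\<bar>"
  by (simp add: cosh_field_def abs_if)

section \<open>The parabolic cylinder function\<close>

lemma
  assumes "Re p > 0"
  shows set_integrable_Gamma:
      "set_integrable lborel {0<..} (\<lambda>t. complex_of_real t powr (p - 1) / of_real (exp t))"
    and set_integral_Gamma:
      "(LINT t:{0<..}|lborel. complex_of_real t powr (p - 1) / of_real (exp t)) = Gamma p"
proof -
  let ?f = "\<lambda>t. complex_of_real t powr (p - 1) / of_real (exp t)"
  have "continuous_on {0<..} ?f"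
    by (intro continuous_intros) auto
  then have "(\<lambda>t. indicator {0<..} t *\<^sub>R ?f t) \<in> borel_measurable lborel"
    using borel_measurable_continuous_on_indicator[of "{0<..}" ?f] by simp
  then show int: "set_integrable lborel {0<..} ?f"
    using absolutely_integrable_Gamma_integral'[OF assms]
    by (simp add: set_integrable_def integrable_completion)
  show "(LINT t:{0<..}|lborel. ?f t) = Gamma p"
    using set_borel_integral_eq_integral(2)[OF int]
      integral_unique[OF Gamma_integral_complex'[OF assms]] by simp
qed

definition weber_integrand :: "complex \<Rightarrow> real \<Rightarrow> real \<Rightarrow> complex" where
  "weber_integrand r z t = of_real t powr r * of_real (exp (- t\<^sup>2 / 2 - z * t))"

definition weber_integral :: "complex \<Rightarrow> real \<Rightarrow> complex" where
  "weber_integral p z = (LINT t:{0<..}|lborel. weber_integrand (p - 1) z t)"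

lemma continuous_on_weber_integrand: "continuous_on {0<..} (weber_integrand r z)"
  unfolding weber_integrand_def by (intro continuous_intros) auto

lemma weber_integrand_measurable:
  "weber_integrand r z \<in> borel_measurable (restrict_space lborel {0<..})"
  using borel_measurable_continuous_on_restrict[OF continuous_on_weber_integrand]
  by (simp only: measurable_cong_sets[OF sets_restrict_space_cong[OF sets_lborel] refl])

lemma norm_weber_integrand:
  "t > 0 \<Longrightarrow> norm (weber_integrand r z t) = t powr Re r * exp (- t\<^sup>2 / 2 - z * t)"
  by (simp add: weber_integrand_def norm_mult norm_powr_real_powr del: of_real_exp)

lemma norm_weber_integrand_le:
  assumes "\<bar>z\<bar> \<le> Z" "t > 0"
  shows "norm (weber_integrand r z t)
      \<le> exp ((Z + 1)\<^sup>2 / 2) * norm (complex_of_real t powr r / of_real (exp t))"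
proof -
  have "- (z * t) \<le> Z * t"
    using assms by (metis abs_le_iff minus_mult_left mult_right_mono less_imp_le)
  moreover have "0 \<le> (t - (Z + 1))\<^sup>2" by simp
  ultimately have "- t\<^sup>2 / 2 - z * t \<le> (Z + 1)\<^sup>2 / 2 - t"
    by (simp add: power2_eq_square algebra_simps)
  then have "t powr Re r * exp (- t\<^sup>2 / 2 - z * t) \<le> t powr Re r * exp ((Z + 1)\<^sup>2 / 2 - t)"
    by (intro mult_left_mono) auto
  with \<open>t > 0\<close> show ?thesis
    by (simp add: norm_weber_integrand norm_divide norm_powr_real_powr exp_diff
      mult_ac del: of_real_exp)
qed

lemma set_integrable_weber_integrand:
  assumes "Re p > 0"
  shows "set_integrable lborel {0<..} (weber_integrand (p - 1) z)"
proof -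
  let ?g = "\<lambda>t. exp ((\<bar>z\<bar> + 1)\<^sup>2 / 2) * norm (complex_of_real t powr (p - 1) / of_real (exp t))"
  have "integrable (restrict_space lborel {0<..}) ?g"
    using set_integrable_Gamma[OF assms]
    by (intro integrable_mult_right integrable_norm) (simp add: integrable_restrict_space_eq_set)
  then have "integrable (restrict_space lborel {0<..}) (weber_integrand (p - 1) z)"
  proof (rule Bochner_Integration.integrable_bound)
    show "AE t in restrict_space lborel {0<..}. norm (weber_integrand (p - 1) z t) \<le> norm (?g t)"
      by (intro AE_I2)
        (auto simp: space_restrict_space intro: order_trans[OF norm_weber_integrand_le])
  qed (rule weber_integrand_measurable)
  then show ?thesis
    by (simp add: integrable_restrict_space_eq_set)
qed

lemma weber_integrand_deriv:
  assumes "t > 0"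
  shows "((\<lambda>z. weber_integrand r z t) has_vector_derivative - weber_integrand (r + 1) z t) (at z)"
    and "(weber_integrand r z has_vector_derivative
      r * weber_integrand (r - 1) z t - of_real z * weber_integrand r z t
        - weber_integrand (r + 1) z t) (at t)"
proof -
  have "((\<lambda>z. complex_of_real (exp (- t\<^sup>2 / 2 - z * t))) has_vector_derivative
      of_real (- t * exp (- t\<^sup>2 / 2 - z * t))) (at z)"
    by (rule has_vector_derivative_of_real) (auto intro!: derivative_eq_intros)
  then show "((\<lambda>z. weber_integrand r z t) has_vector_derivative
      - weber_integrand (r + 1) z t) (at z)"
    unfolding weber_integrand_def
    by (rule has_vector_derivative_eq_rhs[OF has_vector_derivative_mult_right]) (simp add: powr_add)
  have "((\<lambda>t. complex_of_real t powr r) has_vector_derivative r * of_real t powr (r - 1)) (at t)"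
    using assms by (intro has_vector_derivative_real_field has_field_derivative_powr) auto
  moreover have "((\<lambda>t. complex_of_real (exp (- t\<^sup>2 / 2 - z * t))) has_vector_derivative
      of_real ((- t - z) * exp (- t\<^sup>2 / 2 - z * t))) (at t)"
    by (rule has_vector_derivative_of_real) (auto intro!: derivative_eq_intros)
  ultimately show "(weber_integrand r z has_vector_derivative
      r * weber_integrand (r - 1) z t - of_real z * weber_integrand r z t
        - weber_integrand (r + 1) z t) (at t)"
    unfolding weber_integrand_def[abs_def]
    by (rule has_vector_derivative_eq_rhs[OF has_vector_derivative_mult])
       (use assms in \<open>simp add: powr_add algebra_simps del: of_real_exp\<close>)
qed

lemma weber_integral_deriv:
  assumes "Re p > 0"
  shows "(weber_integral p has_vector_derivative - weber_integral (p + 1) z) (at z)"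
proof -
  let ?M = "restrict_space lborel {0::real<..}"
  let ?G = "\<lambda>t. exp ((\<bar>z\<bar> + 1 + 1)\<^sup>2 / 2) * norm (complex_of_real t powr p / of_real (exp t))"
  have "((\<lambda>z. \<integral>t. weber_integrand (p - 1) z t \<partial>?M) has_vector_derivative
      (\<integral>t. - weber_integrand p z t \<partial>?M)) (at z)"
  proof (rule has_vector_derivative_integral_dominated[of z "z - 1" "z + 1" _ _
      "\<lambda>z t. - weber_integrand p z t" ?G])
    show "integrable ?M ?G"
      using set_integrable_Gamma[of "p + 1"] assms
      by (intro integrable_mult_right integrable_norm) (simp add: integrable_restrict_space_eq_set)
    show "integrable ?M (weber_integrand (p - 1) u)" for u
      using set_integrable_weber_integrand[OF assms] by (simp add: integrable_restrict_space_eq_set)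
    show "(\<lambda>t. - weber_integrand p z t) \<in> borel_measurable ?M"
      using weber_integrand_measurable by (rule borel_measurable_uminus)
    fix u t assume u: "u \<in> {z - 1<..<z + 1}" and t: "t \<in> space ?M"
    have "\<bar>u\<bar> \<le> \<bar>z\<bar> + 1" using u by auto
    then show "norm (- weber_integrand p u t) \<le> ?G t"
      using norm_weber_integrand_le[of u "\<bar>z\<bar> + 1" t p] t by (simp add: space_restrict_space)
    show "((\<lambda>z. weber_integrand (p - 1) z t) has_vector_derivative - weber_integrand p u t) (at u)"
      using weber_integrand_deriv(1)[of t "p - 1" u] t by (simp add: space_restrict_space)
  qed auto
  then show ?thesis
    unfolding weber_integral_def[abs_def] by (simp flip: integral_restrict_space_eq_set)
qed

lemma weber_integral_recurrence:
  assumes "Re p > 0"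
  shows "weber_integral (p + 2) z = p * weber_integral p z - of_real z * weber_integral (p + 1) z"
proof -
  let ?f = "\<lambda>t. p * weber_integrand (p - 1) z t - of_real z * weber_integrand p z t
      - weber_integrand (p + 1) z t"
  have int: "set_integrable lborel {0<..} (weber_integrand (p - 1) z)"
      "set_integrable lborel {0<..} (weber_integrand p z)"
      "set_integrable lborel {0<..} (weber_integrand (p + 1) z)"
    using set_integrable_weber_integrand[of p] set_integrable_weber_integrand[of "p + 1"]
      set_integrable_weber_integrand[of "p + 2"] assms by (auto simp: algebra_simps)
  have lim: "(weber_integrand p z \<longlongrightarrow> 0) F"
    if "eventually (\<lambda>t. t > 0) F" "((\<lambda>t. t powr Re p * exp (- t\<^sup>2 / 2 - z * t)) \<longlongrightarrow> 0) F" for F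
    using that(1) by (intro tendsto_norm_zero_cancel[OF Lim_transform_eventually[OF that(2)]])
      (auto elim!: eventually_mono simp: norm_weber_integrand)
  have "(LBINT t=0..\<infinity>. ?f t) = 0 - 0"
  proof (rule interval_integral_FTC_integrable[where F = "weber_integrand p z"])
    have "continuous_on {0<..} ?f"
      by (intro continuous_intros continuous_on_weber_integrand)
    then show "isCont ?f t" if "0 < ereal t" for t
      using that by (simp add: continuous_on_eq_continuous_at)
    show "set_integrable lborel (einterval 0 \<infinity>) ?f"
      unfolding zero_ereal_def einterval_eq
      by (intro set_integral_diff set_integrable_mult_right int)
    show "((weber_integrand p z \<circ> real_of_ereal) \<longlongrightarrow> 0) (at_right 0)"
      unfolding zero_ereal_def ereal_tendsto_simps
      by (rule lim[OF eventually_at_right_less]) (use assms in real_asymp)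
    show "((weber_integrand p z \<circ> real_of_ereal) \<longlongrightarrow> 0) (at_left \<infinity>)"
      unfolding ereal_tendsto_simps
      by (rule lim[OF eventually_gt_at_top]) real_asymp
  qed (auto intro: weber_integrand_deriv)
  then have "(LINT t:{0<..}|lborel. ?f t) = 0"
    by (simp add: interval_lebesgue_integral_0_infty)
  then show ?thesis
    using int by (simp add: weber_integral_def set_integral_diff add.commute)
qed

lemma powr_mult_weber_integral:
  assumes "z > 0"
  shows "of_real z powr p * weber_integral p z
    = (LINT t:{0<..}|lborel. of_real t powr (p - 1) * of_real (exp (- (t / z)\<^sup>2 / 2 - t)))"
proof -
  have integrand: "of_real z powr p * ((1 / z) *\<^sub>R weber_integrand (p - 1) z (1 / z * t))
      = of_real t powr (p - 1) * of_real (exp (- (t / z)\<^sup>2 / 2 - t))" if "t > 0" for t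
  proof -
    have "complex_of_real t = of_real z * of_real (t / z)" using assms by simp
    then have "complex_of_real t powr (p - 1) =
        of_real z powr (p - 1) * of_real (t / z) powr (p - 1)"
      using assms that by (simp only:) (rule powr_times_real, auto)
    then show ?thesis
      using assms
      by (auto simp: weber_integrand_def powr_diff scaleR_conv_of_real simp del: of_real_exp)
  qed
  have "of_real z powr p * weber_integral p z =
      (LINT t:{0<..}|lborel. of_real z powr p * ((1 / z) *\<^sub>R weber_integrand (p - 1) z (1 / z * t)))"
    unfolding weber_integral_def using assms
    by (subst set_integral_Ioi_scale[of "1 / z"]) simp_all
  also have "\<dots> =
      (LINT t:{0<..}|lborel. of_real t powr (p - 1) * of_real (exp (- (t / z)\<^sup>2 / 2 - t)))"
    by (rule set_lebesgue_integral_cong[OF _ allI[OF impI[OF integrand]]]) simp_all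
  finally show ?thesis .
qed

lemma weber_integral_asymp:
  assumes "Re p > 0"
  shows "((\<lambda>z. of_real z powr p * weber_integral p z) \<longlongrightarrow> Gamma p) at_top"
proof -
  let ?M = "restrict_space lborel {0::real<..}"
  let ?g = "\<lambda>t. complex_of_real t powr (p - 1) / of_real (exp t)"
  let ?h = "\<lambda>z t. complex_of_real t powr (p - 1) * of_real (exp (- (t / z)\<^sup>2 / 2 - t))"
  have int_g: "integrable ?M ?g"
    using set_integrable_Gamma[OF assms] by (simp add: integrable_restrict_space_eq_set)
  have exp_t: "?g t = complex_of_real t powr (p - 1) * of_real (exp (- t))" for t
    by (simp only: exp_minus of_real_inverse divide_inverse)
  have "((\<lambda>z. \<integral>t. ?h z t \<partial>?M) \<longlongrightarrow> (\<integral>t. ?g t \<partial>?M)) at_top"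
  proof (rule integral_dominated_convergence_at_top[where w = "\<lambda>t. norm (?g t)"])
    show "?g \<in> borel_measurable ?M" "integrable ?M (\<lambda>t. norm (?g t))"
      using int_g by auto
    have "(\<lambda>t. ?g t * of_real (exp (- (t / z)\<^sup>2 / 2))) \<in> borel_measurable ?M" for z
      by (intro borel_measurable_times \<open>?g \<in> borel_measurable ?M\<close>
        measurable_restrict_space1) measurable
    then show "?h z \<in> borel_measurable ?M" for z
      unfolding exp_t by (simp add: exp_diff exp_minus field_simps)
    show "eventually (\<lambda>z. AE t in ?M. norm (?h z t) \<le> norm (?g t)) at_top"
      unfolding exp_t norm_mult
      by (intro always_eventually allI AE_I2 mult_left_mono) (simp_all del: of_real_exp)
    show "AE t in ?M. ((\<lambda>z. ?h z t) \<longlongrightarrow> ?g t) at_top"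
    proof (intro AE_I2)
      fix t :: real
      have "((\<lambda>z. exp (- (t / z)\<^sup>2 / 2 - t)) \<longlongrightarrow> exp (- 0\<^sup>2 / 2 - t)) at_top"
        by (intro tendsto_intros real_tendsto_divide_at_top[OF tendsto_const filterlim_ident]) auto
      then show "((\<lambda>z. ?h z t) \<longlongrightarrow> ?g t) at_top"
        unfolding exp_t by (intro tendsto_mult tendsto_const tendsto_of_real) simp
    qed
  qed
  then have "((\<lambda>z. LINT t:{0<..}|lborel. ?h z t) \<longlongrightarrow> Gamma p) at_top"
    by (simp add: integral_restrict_space_eq_set set_integral_Gamma[OF assms])
  then show ?thesis
  proof (rule Lim_transform_eventually)
    show "eventually (\<lambda>z. (LINT t:{0<..}|lborel. ?h z t) =
        of_real z powr p * weber_integral p z) at_top"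
      using eventually_gt_at_top[of 0] by eventually_elim (simp only: powr_mult_weber_integral)
  qed
qed

abbreviation weber_potential :: "complex \<Rightarrow> real \<Rightarrow> complex" where
  "weber_potential \<mu> z \<equiv> of_real (z\<^sup>2 / 4) - \<mu> - 1/2"

definition weber_gauge :: "complex \<Rightarrow> real \<Rightarrow> complex" where
  "weber_gauge \<mu> z = exp (- of_real (z\<^sup>2 / 4)) * of_real z powr \<mu>"

lemma weber_gauge_add1: "z > 0 \<Longrightarrow> weber_gauge (\<mu> + 1) z = of_real z * weber_gauge \<mu> z"
  by (simp add: weber_gauge_def powr_add)

lemma weber_gauge_nonzero: "z > 0 \<Longrightarrow> weber_gauge \<mu> z \<noteq> 0"
  by (simp add: weber_gauge_def)

lemma norm_weber_gauge: "z > 0 \<Longrightarrow> norm (weber_gauge \<mu> z) = exp (- z\<^sup>2 / 4) * z powr Re \<mu>"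
  by (simp add: weber_gauge_def norm_mult norm_powr_real_powr)

lemma power_mult_weber_gauge_tendsto_0:
  "((\<lambda>z. of_real (z ^ k) * weber_gauge \<mu> z) \<longlongrightarrow> 0) at_top"
proof (rule tendsto_norm_zero_cancel, rule Lim_transform_eventually)
  show "((\<lambda>z. z powr real k * (exp (- z\<^sup>2 / 4) * z powr Re \<mu>)) \<longlongrightarrow> 0) at_top"
    by real_asymp
  show "eventually (\<lambda>z. z powr real k * (exp (- z\<^sup>2 / 4) * z powr Re \<mu>) =
      norm (of_real (z ^ k) * weber_gauge \<mu> z)) at_top"
    using eventually_gt_at_top[of 0]
    by eventually_elim (simp add: norm_mult norm_weber_gauge norm_power powr_realpow)
qed

lemma weber_gauge_tendsto_0: "(weber_gauge \<mu> \<longlongrightarrow> 0) at_top"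
  using power_mult_weber_gauge_tendsto_0[of 0 \<mu>] by simp

lemma weber_potential_mult_gauge_tendsto_0:
  "((\<lambda>z. weber_potential \<mu> z * weber_gauge \<nu> z) \<longlongrightarrow> 0) at_top"
proof -
  have "((\<lambda>z. of_real (z ^ 2) * weber_gauge \<nu> z / 4 - (\<mu> + 1/2) * weber_gauge \<nu> z)
      \<longlongrightarrow> 0 / 4 - (\<mu> + 1/2) * 0) at_top"
    by (intro tendsto_intros power_mult_weber_gauge_tendsto_0 weber_gauge_tendsto_0) auto
  then show ?thesis by (simp add: algebra_simps)
qed

lemma parabolic_D_eqI:
  assumes sol: "ode2_solution_on UNIV (weber_potential \<mu>) f f'"
    and asymp: "((\<lambda>z. f z / weber_gauge \<mu> z) \<longlongrightarrow> 1) at_top"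
  shows "parabolic_D \<mu> = f"
proof -
  have "parabolic_D \<mu> = (THE f. (\<exists>f'. ode2_solution_on UNIV (weber_potential \<mu>) f f') \<and>
      ((\<lambda>z. f z / weber_gauge \<mu> z) \<longlongrightarrow> 1) at_top)"
    unfolding parabolic_D_def ode2_solution_on_def weber_gauge_def by simp
  also have "\<dots> = f"
  proof (rule the_equality)
    fix h assume h: "(\<exists>h'. ode2_solution_on UNIV (weber_potential \<mu>) h h') \<and>
      ((\<lambda>z. h z / weber_gauge \<mu> z) \<longlongrightarrow> 1) at_top"
    then obtain h' where sol_h: "ode2_solution_on UNIV (weber_potential \<mu>) h h'" by blast
    have "continuous_on UNIV (weber_potential \<mu>)"
      by (intro continuous_intros) auto
    then have "h z = f z" for z
      using h asymp weber_gauge_tendsto_0 weber_potential_mult_gauge_tendsto_0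
      by (intro recessive_solution_unique[OF sol_h sol, where \<phi> = "weber_gauge \<mu>"])
        (auto simp: is_interval_univ)
    then show "h = f" ..
  qed (use assms in blast)
  finally show ?thesis .
qed

text \<open>The asymptotics of the derivative are carried along because the raising operator of
  \<open>is_weber_recessive_raise\<close> involves it.\<close>
definition is_weber_recessive :: "complex \<Rightarrow> (real \<Rightarrow> complex) \<Rightarrow> (real \<Rightarrow> complex) \<Rightarrow> bool" where
  "is_weber_recessive \<mu> f f' \<longleftrightarrow>
    ode2_solution_on UNIV (weber_potential \<mu>) f f' \<and>
    ((\<lambda>z. f z / weber_gauge \<mu> z) \<longlongrightarrow> 1) at_top \<and>
    ((\<lambda>z. f' z / (of_real z * weber_gauge \<mu> z)) \<longlongrightarrow> - 1/2) at_top"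

definition weber_solution :: "complex \<Rightarrow> real \<Rightarrow> complex" where
  "weber_solution p z = of_real (exp (- z\<^sup>2 / 4)) / Gamma p * weber_integral p z"

lemma Re_pos_not_nonpos_Ints: "Re p > 0 \<Longrightarrow> p \<notin> \<int>\<^sub>\<le>\<^sub>0"
  by (auto simp: nonpos_Ints_def)

lemma has_vector_derivative_gaussian:
  "((\<lambda>u. complex_of_real (exp (- u\<^sup>2 / 4))) has_vector_derivative
    of_real (- u / 2 * exp (- u\<^sup>2 / 4))) (at u)"
  by (rule has_vector_derivative_of_real) (auto intro!: derivative_eq_intros)

lemma weber_solution_ode:
  assumes "Re p > 0"
  shows "ode2_solution_on UNIV (weber_potential (- p)) (weber_solution p)
    (\<lambda>z. - of_real z / 2 * weber_solution p z - p * weber_solution (p + 1) z)"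
proof -
  let ?a = "\<lambda>z. of_real (exp (- z\<^sup>2 / 4)) / Gamma p" and ?b = "\<lambda>z::real. - complex_of_real z / 2"
  have "ode2_solution_on UNIV (\<lambda>z. p + (?b z)\<^sup>2 + (- 1/2)) (\<lambda>z. ?a z * weber_integral p z)
      (\<lambda>z. ?a z * (?b z * weber_integral p z + - weber_integral (p + 1) z))"
  proof (rule ode2_solution_on_liouville)
    fix z
    show "(weber_integral p has_vector_derivative - weber_integral (p + 1) z) (at z)"
      by (rule weber_integral_deriv[OF assms])
    have "(weber_integral (p + 1) has_vector_derivative - weber_integral (p + 2) z) (at z)"
      using weber_integral_deriv[of "p + 1" z] assms by (simp add: add.assoc)
    then show "((\<lambda>z. - weber_integral (p + 1) z) has_vector_derivative
        p * weber_integral p z - 2 * ?b z * - weber_integral (p + 1) z) (at z)"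
      using has_vector_derivative_minus by (force simp: weber_integral_recurrence[OF assms])
    show "(?a has_vector_derivative ?b z * ?a z) (at z)"
      by (rule has_vector_derivative_eq_rhs[OF has_vector_derivative_divide[OF
        has_vector_derivative_gaussian]]) simp
    have "((\<lambda>z. complex_of_real (- z / 2)) has_vector_derivative of_real (- 1/2)) (at z)"
      by (rule has_vector_derivative_of_real) (auto intro!: derivative_eq_intros)
    then show "(?b has_vector_derivative - 1/2) (at z)" by simp
  qed
  moreover have "(\<lambda>z. p + (?b z)\<^sup>2 + (- 1/2)) = weber_potential (- p)"
    by (simp add: fun_eq_iff power2_eq_square)
  moreover have "(\<lambda>z. ?a z * weber_integral p z) = weber_solution p"
    by (simp add: fun_eq_iff weber_solution_def)
  moreover have "p \<noteq> 0" "Gamma (p + 1) = p * Gamma p"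
    using assms Gamma_plus1[OF Re_pos_not_nonpos_Ints[OF assms]] by auto
  then have "(\<lambda>z. ?a z * (?b z * weber_integral p z + - weber_integral (p + 1) z)) =
      (\<lambda>z. - of_real z / 2 * weber_solution p z - p * weber_solution (p + 1) z)"
    by (simp add: fun_eq_iff weber_solution_def right_diff_distrib mult_ac)
  ultimately show ?thesis by (simp only:)
qed

lemma weber_solution_asymp:
  assumes "Re p > 0"
  shows "((\<lambda>z. weber_solution p z / weber_gauge (- p) z) \<longlongrightarrow> 1) at_top"
proof (rule Lim_transform_eventually)
  have "Gamma p \<noteq> 0"
    using Re_pos_not_nonpos_Ints[OF assms] by (simp add: Gamma_eq_zero_iff)
  then show "((\<lambda>z. of_real z powr p * weber_integral p z / Gamma p) \<longlongrightarrow> 1) at_top"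
    using tendsto_divide[OF weber_integral_asymp[OF assms] tendsto_const] by force
  show "eventually (\<lambda>z. of_real z powr p * weber_integral p z / Gamma p =
      weber_solution p z / weber_gauge (- p) z) at_top"
    using eventually_gt_at_top[of 0]
    by eventually_elim
      (simp add: weber_solution_def weber_gauge_def powr_minus exp_minus
        field_simps flip: exp_of_real)
qed

lemma of_real_inverse_square_tendsto_0: "((\<lambda>z::real. complex_of_real (1 / z\<^sup>2)) \<longlongrightarrow> 0) at_top"
proof -
  have "((\<lambda>z::real. 1 / z\<^sup>2) \<longlongrightarrow> 0) at_top"
    by real_asymp
  from tendsto_of_real[OF this] show ?thesis
    by (simp only: of_real_0)
qed

lemma is_weber_recessive_weber_solution:
  assumes "Re p > 0"
  shows "is_weber_recessive (- p) (weber_solution p)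
    (\<lambda>z. - of_real z / 2 * weber_solution p z - p * weber_solution (p + 1) z)"
  unfolding is_weber_recessive_def
proof (intro conjI weber_solution_ode weber_solution_asymp assms)
  let ?r = "\<lambda>p z. weber_solution p z / weber_gauge (- p) z"
  show "((\<lambda>z. (- of_real z / 2 * weber_solution p z - p * weber_solution (p + 1) z)
      / (of_real z * weber_gauge (- p) z))
      \<longlongrightarrow> - 1/2) at_top"
  proof (rule Lim_transform_eventually)
    have "((\<lambda>z. - (?r p z / 2) - p * (?r (p + 1) z * of_real (1 / z\<^sup>2)))
        \<longlongrightarrow> - (1 / 2) - p * (1 * 0)) at_top"
      using assms by (intro tendsto_intros weber_solution_asymp
        of_real_inverse_square_tendsto_0) auto
    then show "((\<lambda>z. - (?r p z / 2) - p * (?r (p + 1) z * of_real (1 / z\<^sup>2))) \<longlongrightarrow> - 1/2) at_top"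
      by simp
    show "eventually (\<lambda>z. - (?r p z / 2) - p * (?r (p + 1) z * of_real (1 / z\<^sup>2)) =
        (- of_real z / 2 * weber_solution p z - p * weber_solution (p + 1) z)
        / (of_real z * weber_gauge (- p) z)) at_top"
      using eventually_gt_at_top[of 0]
    proof eventually_elim
      case (elim z)
      have "weber_gauge (- p) z = of_real z * weber_gauge (- (p + 1)) z"
        using weber_gauge_add1[OF elim, of "- (p + 1)"] by simp
      with elim weber_gauge_nonzero[OF elim] show ?case
        by (simp add: field_simps power2_eq_square)
    qed
  qed
qed

lemma weber_ode_raise:
  assumes sol: "ode2_solution_on UNIV (weber_potential \<mu>) f f'"
  defines "f\<^sub>1 \<equiv> \<lambda>z. of_real z * f z / 2 - f' z"
  shows "ode2_solution_on UNIV (weber_potential (\<mu> + 1)) f\<^sub>1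
    (\<lambda>z. (\<mu> + 1) * f z - of_real z * f\<^sub>1 z / 2)"
proof -
  note D = ode2_solution_onD[OF sol UNIV_I] has_vector_derivative_of_real[OF DERIV_ident]
  have f\<^sub>1: "(f\<^sub>1 has_vector_derivative (\<mu> + 1) * f z - of_real z * f\<^sub>1 z / 2) (at z)" for z
    unfolding f\<^sub>1_def
    by (rule has_vector_derivative_eq_rhs,
        (rule has_vector_derivative_divide has_vector_derivative_diff
          has_vector_derivative_mult D)+)
       (simp add: field_simps power2_eq_square)
  have "((\<lambda>z. (\<mu> + 1) * f z - of_real z * f\<^sub>1 z / 2) has_vector_derivative
      weber_potential (\<mu> + 1) z * f\<^sub>1 z) (at z)" for z
    by (rule has_vector_derivative_eq_rhs,
        (rule has_vector_derivative_divide has_vector_derivative_diff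
          has_vector_derivative_mult_right
          has_vector_derivative_mult D f\<^sub>1)+)
       (simp add: f\<^sub>1_def field_simps power2_eq_square)
  with f\<^sub>1 show ?thesis by (simp add: ode2_solution_on_def)
qed

lemma is_weber_recessive_raise:
  assumes "is_weber_recessive \<mu> f f'"
  defines "f\<^sub>1 \<equiv> \<lambda>z. of_real z * f z / 2 - f' z"
  shows "is_weber_recessive (\<mu> + 1) f\<^sub>1 (\<lambda>z. (\<mu> + 1) * f z - of_real z * f\<^sub>1 z / 2)"
proof -
  let ?r = "\<lambda>z. f z / weber_gauge \<mu> z" and ?r\<^sub>1 = "\<lambda>z. f\<^sub>1 z / weber_gauge (\<mu> + 1) z"
  have r: "(?r \<longlongrightarrow> 1) at_top" and r': "((\<lambda>z. f' z / (of_real z * weber_gauge \<mu> z)) \<longlongrightarrow> - 1/2) at_top"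
    using assms(1) by (auto simp: is_weber_recessive_def)
  have r\<^sub>1: "(?r\<^sub>1 \<longlongrightarrow> 1) at_top"
  proof (rule Lim_transform_eventually)
    show "((\<lambda>z. ?r z / 2 - f' z / (of_real z * weber_gauge \<mu> z)) \<longlongrightarrow> 1) at_top"
      using tendsto_diff[OF tendsto_divide[OF r tendsto_const[of 2]] r'] by simp
    show "eventually (\<lambda>z. ?r z / 2 - f' z / (of_real z * weber_gauge \<mu> z) = ?r\<^sub>1 z) at_top"
      using eventually_gt_at_top[of 0]
      by eventually_elim
        (simp only: weber_gauge_add1, simp add: f\<^sub>1_def weber_gauge_nonzero field_simps)
  qed
  have "((\<lambda>z. ((\<mu> + 1) * f z - of_real z * f\<^sub>1 z / 2) / (of_real z * weber_gauge (\<mu> + 1) z))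
      \<longlongrightarrow> - 1/2) at_top"
  proof (rule Lim_transform_eventually)
    have "((\<lambda>z. (\<mu> + 1) * (of_real (1 / z\<^sup>2) * ?r z) - ?r\<^sub>1 z / 2)
        \<longlongrightarrow> (\<mu> + 1) * (0 * 1) - 1 / 2) at_top"
      by (intro tendsto_intros of_real_inverse_square_tendsto_0 r r\<^sub>1) auto
    then show "((\<lambda>z. (\<mu> + 1) * (of_real (1 / z\<^sup>2) * ?r z) - ?r\<^sub>1 z / 2) \<longlongrightarrow> - 1/2) at_top" by simp
    show "eventually (\<lambda>z. (\<mu> + 1) * (of_real (1 / z\<^sup>2) * ?r z) - ?r\<^sub>1 z / 2 =
        ((\<mu> + 1) * f z - of_real z * f\<^sub>1 z / 2) / (of_real z * weber_gauge (\<mu> + 1) z)) at_top"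
      using eventually_gt_at_top[of 0]
      by eventually_elim
        (simp only: weber_gauge_add1, simp add: weber_gauge_nonzero field_simps power2_eq_square)
  qed
  with r\<^sub>1 show ?thesis
    using weber_ode_raise[of \<mu> f f'] assms by (simp add: is_weber_recessive_def)
qed

lemma is_weber_recessive_exists: "\<exists>f f'. is_weber_recessive \<mu> f f'"
proof -
  have "\<exists>f f'. is_weber_recessive \<mu> f f'" if "Re \<mu> < real n" for n
    using that
  proof (induction n arbitrary: \<mu>)
    case 0
    then show ?case using is_weber_recessive_weber_solution[of "- \<mu>"] by auto
  next
    case (Suc n)
    then obtain f f' where "is_weber_recessive (\<mu> - 1) f f'" by fastforce
    from is_weber_recessive_raise[OF this] show ?case by auto
  qed
  then show ?thesis using reals_Archimedean2[of "Re \<mu>"] by blast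
qed

lemma parabolic_D_raise:
  obtains D' where "is_weber_recessive \<mu> (parabolic_D \<mu>) D'"
    and "parabolic_D (\<mu> + 1) = (\<lambda>z. of_real z * parabolic_D \<mu> z / 2 - D' z)"
proof -
  obtain f f' where f: "is_weber_recessive \<mu> f f'"
    using is_weber_recessive_exists by blast
  then have "parabolic_D \<mu> = f"
    unfolding is_weber_recessive_def by (auto intro: parabolic_D_eqI)
  moreover have "parabolic_D (\<mu> + 1) = (\<lambda>z. of_real z * f z / 2 - f' z)"
    using is_weber_recessive_raise[OF f] unfolding is_weber_recessive_def
    by (auto intro: parabolic_D_eqI)
  ultimately show thesis
    using f that[of f'] by simp
qed

lemma parabolic_D_deriv:
  "(parabolic_D \<mu> has_vector_derivative
      of_real z * parabolic_D \<mu> z / 2 - parabolic_D (\<mu> + 1) z) (at z)"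
proof -
  obtain D' where "is_weber_recessive \<mu> (parabolic_D \<mu>) D'"
    and "parabolic_D (\<mu> + 1) = (\<lambda>z. of_real z * parabolic_D \<mu> z / 2 - D' z)"
    by (rule parabolic_D_raise)
  then show ?thesis
    by (simp add: is_weber_recessive_def ode2_solution_on_def)
qed

lemma parabolic_D_asymp: "((\<lambda>z. parabolic_D \<mu> z / weber_gauge \<mu> z) \<longlongrightarrow> 1) at_top"
  using parabolic_D_raise[of \<mu>] unfolding is_weber_recessive_def by blast

lemma parabolic_D_recurrence:
  "parabolic_D (\<mu> + 2) z = of_real z * parabolic_D (\<mu> + 1) z - (\<mu> + 1) * parabolic_D \<mu> z"
proof -
  let ?D = parabolic_D
  obtain D' where D': "is_weber_recessive \<mu> (?D \<mu>) D'"
    and D1: "?D (\<mu> + 1) = (\<lambda>z. of_real z * ?D \<mu> z / 2 - D' z)"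
    by (rule parabolic_D_raise)
  have "(?D (\<mu> + 1) has_vector_derivative (\<mu> + 1) * ?D \<mu> z - of_real z * ?D (\<mu> + 1) z / 2) (at z)"
    using is_weber_recessive_raise[OF D']
    by (simp add: D1 is_weber_recessive_def ode2_solution_on_def)
  with parabolic_D_deriv[of "\<mu> + 1" z]
  have "of_real z * ?D (\<mu> + 1) z / 2 - ?D (\<mu> + 1 + 1) z =
      (\<mu> + 1) * ?D \<mu> z - of_real z * ?D (\<mu> + 1) z / 2"
    by (rule vector_derivative_unique_at)
  then have "?D (\<mu> + 1 + 1) z =
      (of_real z * ?D (\<mu> + 1) z / 2 + of_real z * ?D (\<mu> + 1) z / 2) - (\<mu> + 1) * ?D \<mu> z"
    by (simp only: diff_eq_eq eq_diff_eq) (simp add: algebra_simps)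
  then show ?thesis by (simp add: add.assoc)
qed

definition damped_D :: "complex \<Rightarrow> real \<Rightarrow> complex" where
  "damped_D \<mu> u = of_real (exp (- u\<^sup>2 / 4)) * parabolic_D \<mu> u"

lemma damped_D_deriv: "(damped_D \<mu> has_vector_derivative - damped_D (\<mu> + 1) u) (at u)"
  unfolding damped_D_def[abs_def]
  by (rule has_vector_derivative_eq_rhs[OF has_vector_derivative_mult[OF
    has_vector_derivative_gaussian parabolic_D_deriv]])
     (simp add: algebra_simps del: of_real_exp)

lemma continuous_on_damped_D: "continuous_on S (damped_D \<mu>)"
  by (rule continuous_on_if_has_vector_derivative[OF damped_D_deriv])

lemma damped_D_recurrence:
  "damped_D (\<mu> + 2) u = of_real u * damped_D (\<mu> + 1) u - (\<mu> + 1) * damped_D \<mu> u"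
  by (simp add: damped_D_def parabolic_D_recurrence algebra_simps)

lemma damped_D_asymp:
  "((\<lambda>u. damped_D \<mu> u / (of_real (exp (- u\<^sup>2 / 2)) * of_real u powr \<mu>)) \<longlongrightarrow> 1) at_top"
proof (rule Lim_transform_eventually[OF parabolic_D_asymp])
  have "exp (- u\<^sup>2 / 2) = exp (- u\<^sup>2 / 4) * exp (- (u\<^sup>2 / 4))" for u :: real
    by (simp flip: exp_add)
  moreover have "exp (- complex_of_real (u\<^sup>2 / 4)) = of_real (exp (- (u\<^sup>2 / 4)))" for u
    by (simp flip: exp_of_real)
  ultimately show "eventually (\<lambda>u. parabolic_D \<mu> u / weber_gauge \<mu> u =
      damped_D \<mu> u / (of_real (exp (- u\<^sup>2 / 2)) * of_real u powr \<mu>)) at_top"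
    by (intro always_eventually) (simp add: damped_D_def weber_gauge_def del: of_real_exp)
qed

lemma gaussian_decay_damped_D: "gaussian_decay (damped_D \<mu>)"
proof -
  have "(parabolic_D \<mu> \<longlongrightarrow> 0) at_top"
    using tendsto_mult_zero_of_ratio[OF parabolic_D_asymp, of "\<lambda>_. 1"] weber_gauge_tendsto_0 by simp
  moreover have "continuous_on {0..} (parabolic_D \<mu>)"
    by (rule continuous_on_if_has_vector_derivative[OF parabolic_D_deriv])
  ultimately obtain C where "\<And>u. u \<ge> 0 \<Longrightarrow> norm (parabolic_D \<mu> u) \<le> C"
    using bounded_image_atLeast_if_tendsto unfolding bounded_iff by (metis atLeast_iff imageI)
  then show ?thesis
    unfolding gaussian_decay_def damped_D_def
    by (intro exI[of _ C] exI[of _ "1/4"])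
      (simp add: norm_mult mult.commute mult_left_mono del: of_real_exp)
qed

section \<open>Integrals against \<open>cosh (s / 2)\<close>\<close>

definition cosh_integrand :: "complex \<Rightarrow> nat \<Rightarrow> (real \<Rightarrow> complex) \<Rightarrow> real \<Rightarrow> real \<Rightarrow> complex" where
  "cosh_integrand \<nu> k \<Phi> y s =
      exp (\<nu> * of_real s) * of_real (cosh (s / 2) ^ k) * \<Phi> (y * cosh (s / 2))"

definition cosh_integral :: "complex \<Rightarrow> nat \<Rightarrow> (real \<Rightarrow> complex) \<Rightarrow> real \<Rightarrow> complex" where
  "cosh_integral \<nu> k \<Phi> y = (\<integral>s. cosh_integrand \<nu> k \<Phi> y s \<partial>lborel)"

lemma norm_exp_mult_of_real_le: "norm (exp (\<nu> * complex_of_real s)) \<le> exp (norm \<nu> * \<bar>s\<bar>)"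
  using norm_exp[of "\<nu> * complex_of_real s"] by (simp add: norm_mult)

lemma cosh_integrand_dominated:
  assumes "gaussian_decay \<Phi>" "a > 0"
  obtains C L \<epsilon> where "\<epsilon> > 0"
    "\<And>y s. y \<ge> a \<Longrightarrow> norm (cosh_integrand \<nu> k \<Phi> y s) \<le> C * exp (L * \<bar>s\<bar> - \<epsilon> * s\<^sup>2)"
proof -
  obtain C \<delta> where C: "C \<ge> 0" and \<delta>: "\<delta> > 0"
    and \<Phi>: "\<And>u. u \<ge> 0 \<Longrightarrow> norm (\<Phi> u) \<le> C * exp (- \<delta> * u\<^sup>2)"
    using gaussian_decayE[OF assms(1)] by blast
  let ?\<epsilon> = "\<delta> * a\<^sup>2 / 4"
  have "norm (cosh_integrand \<nu> k \<Phi> y s) \<le> C * exp ((norm \<nu> + real k) * \<bar>s\<bar> - ?\<epsilon> * s\<^sup>2)"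
    if y: "y \<ge> a" for y s
  proof -
    let ?c = "cosh (s / 2)"
    have "(s / 2)\<^sup>2 \<le> ?c\<^sup>2"
      using square_le_sinh_square[of "s / 2"] by (simp add: cosh_square_eq)
    then have "a\<^sup>2 * (s / 2)\<^sup>2 \<le> y\<^sup>2 * ?c\<^sup>2"
      using y \<open>a > 0\<close> by (intro mult_mono power_mono[of a y]) auto
    then have "\<delta> * (a\<^sup>2 * (s / 2)\<^sup>2) \<le> \<delta> * (y\<^sup>2 * ?c\<^sup>2)"
      using \<delta> by (intro mult_left_mono) auto
    then have "exp (- \<delta> * (y * ?c)\<^sup>2) \<le> exp (- (?\<epsilon> * s\<^sup>2))"
      by (simp add: power_mult_distrib power_divide)
    then have \<Phi>_le: "norm (\<Phi> (y * ?c)) \<le> C * exp (- (?\<epsilon> * s\<^sup>2))"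
      using y \<open>a > 0\<close> by (intro order_trans[OF \<Phi>] mult_left_mono C) auto
    have "?c \<le> exp \<bar>s\<bar>"
      using cosh_le_exp_abs[of "s / 2"] by (rule order_trans) simp
    then have cosh_le: "?c ^ k \<le> exp (real k * \<bar>s\<bar>)"
      using power_mono[of ?c "exp \<bar>s\<bar>" k] by (simp add: exp_of_nat_mult)
    have "norm (cosh_integrand \<nu> k \<Phi> y s) = norm (exp (\<nu> * of_real s)) * ?c ^ k * norm (\<Phi> (y * ?c))"
      by (simp add: cosh_integrand_def norm_mult norm_power)
    also have "\<dots> \<le> exp (norm \<nu> * \<bar>s\<bar>) * exp (real k * \<bar>s\<bar>) * (C * exp (- (?\<epsilon> * s\<^sup>2)))"
      by (intro mult_mono norm_exp_mult_of_real_le cosh_le \<Phi>_le) auto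
    also have "\<dots> = C * exp (norm \<nu> * \<bar>s\<bar> + real k * \<bar>s\<bar> + - (?\<epsilon> * s\<^sup>2))"
      by (simp only: exp_add mult_ac)
    finally show ?thesis
      by (simp add: distrib_right)
  qed
  with \<delta> \<open>a > 0\<close> show thesis
    by (intro that[of ?\<epsilon> C "norm \<nu> + real k"]) auto
qed

lemma continuous_on_cosh_integrand:
  assumes "continuous_on UNIV \<Phi>"
  shows "continuous_on S (cosh_integrand \<nu> k \<Phi> y)"
  unfolding cosh_integrand_def
  by (intro continuous_intros continuous_on_compose2[OF assms]) auto

lemma cosh_integrand_measurable:
  assumes "continuous_on UNIV \<Phi>"
  shows "cosh_integrand \<nu> k \<Phi> y \<in> borel_measurable lborel"
  using borel_measurable_continuous_onI[OF continuous_on_cosh_integrand[OF assms]] by simp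

lemma integrable_cosh_integrand:
  assumes "continuous_on UNIV \<Phi>" "gaussian_decay \<Phi>" "y > 0"
  shows "integrable lborel (cosh_integrand \<nu> k \<Phi> y)"
proof -
  obtain C L \<epsilon> where "\<epsilon> > 0"
    and bound: "\<And>s. norm (cosh_integrand \<nu> k \<Phi> y s) \<le> C * exp (L * \<bar>s\<bar> - \<epsilon> * s\<^sup>2)"
    using cosh_integrand_dominated[OF assms(2,3)] by (metis order_refl)
  show ?thesis
  proof (rule Bochner_Integration.integrable_bound)
    show "integrable lborel (\<lambda>s. C * exp (L * \<bar>s\<bar> - \<epsilon> * s\<^sup>2))"
      using \<open>\<epsilon> > 0\<close> by (intro integrable_mult_right integrable_exp_abs_minus_square)
    show "AE s in lborel. norm (cosh_integrand \<nu> k \<Phi> y s) \<le> norm (C * exp (L * \<bar>s\<bar> - \<epsilon> * s\<^sup>2))"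
      unfolding real_norm_def by (intro AE_I2 order_trans[OF bound abs_ge_self])
  qed (rule cosh_integrand_measurable[OF assms(1)])
qed

lemma cosh_integral_deriv:
  assumes \<Phi>: "\<And>u. (\<Phi> has_vector_derivative \<Phi>' u) (at u)" "gaussian_decay \<Phi>"
    and \<Phi>': "continuous_on UNIV \<Phi>'" "gaussian_decay \<Phi>'" and "y > 0"
  shows "(cosh_integral \<nu> k \<Phi> has_vector_derivative cosh_integral \<nu> (Suc k) \<Phi>' y) (at y)"
proof -
  obtain C L \<epsilon> where "\<epsilon> > 0"
    and bound: "\<And>u s. u \<ge> y / 2 \<Longrightarrow> norm (cosh_integrand \<nu> (Suc k) \<Phi>' u s)
        \<le> C * exp (L * \<bar>s\<bar> - \<epsilon> * s\<^sup>2)"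
    using cosh_integrand_dominated[OF \<Phi>'(2) half_gt_zero[OF \<open>y > 0\<close>]] by metis
  show ?thesis
    unfolding cosh_integral_def[abs_def]
  proof (rule has_vector_derivative_integral_dominated[of y "y / 2" "y + 1"])
    show "integrable lborel (\<lambda>s. C * exp (L * \<bar>s\<bar> - \<epsilon> * s\<^sup>2))"
      using \<open>\<epsilon> > 0\<close> by (intro integrable_mult_right integrable_exp_abs_minus_square)
    fix u s assume u: "u \<in> {y / 2<..<y + 1}"
    have "continuous_on UNIV \<Phi>"
      by (rule continuous_on_if_has_vector_derivative[OF \<Phi>(1)])
    then show "integrable lborel (cosh_integrand \<nu> k \<Phi> u)"
      using u \<open>y > 0\<close> by (intro integrable_cosh_integrand \<Phi>(2)) auto
    show "norm (cosh_integrand \<nu> (Suc k) \<Phi>' u s) \<le> C * exp (L * \<bar>s\<bar> - \<epsilon> * s\<^sup>2)"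
      using u by (intro bound) auto
    have "((\<lambda>u. \<Phi> (u * cosh (s / 2))) has_vector_derivative
        of_real (cosh (s / 2)) * \<Phi>' (u * cosh (s / 2))) (at u)"
      by (rule has_vector_derivative_chain_real[OF _ \<Phi>(1)]) (auto intro!: derivative_eq_intros)
    from has_vector_derivative_mult_right[OF this,
        of "exp (\<nu> * of_real s) * of_real (cosh (s / 2) ^ k)"]
    show "((\<lambda>u. cosh_integrand \<nu> k \<Phi> u s) has_vector_derivative
        cosh_integrand \<nu> (Suc k) \<Phi>' u s) (at u)"
      by (simp add: cosh_integrand_def mult_ac)
  qed (use \<open>y > 0\<close> cosh_integrand_measurable[OF \<Phi>'(1)] in auto)
qed

lemma cosh_integrand_tendsto_0:
  assumes "gaussian_decay \<Phi>" "y > 0" and F: "F \<in> {at_bot, at_top}"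
  shows "(cosh_integrand \<nu> k \<Phi> y \<longlongrightarrow> 0) F"
proof -
  obtain C L \<epsilon> where \<epsilon>: "\<epsilon> > 0"
    and bound: "\<And>s. norm (cosh_integrand \<nu> k \<Phi> y s) \<le> C * exp (L * \<bar>s\<bar> - \<epsilon> * s\<^sup>2)"
    using cosh_integrand_dominated[OF assms(1,2)] by (metis order_refl)
  have "((\<lambda>s. exp (L * s - \<epsilon> * s\<^sup>2)) \<longlongrightarrow> 0) at_top"
    using \<epsilon> by real_asymp
  moreover have "F \<le> at_infinity"
    using F at_top_le_at_infinity at_bot_le_at_infinity by blast
  then have "filterlim (norm :: real \<Rightarrow> real) at_top F"
    by (rule filterlim_mono[OF filterlim_norm_at_top order_refl])
  ultimately have "((\<lambda>s. exp (L * norm s - \<epsilon> * (norm s)\<^sup>2)) \<longlongrightarrow> 0) F"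
    by (rule filterlim_compose)
  then have "((\<lambda>s. exp (L * \<bar>s\<bar> - \<epsilon> * s\<^sup>2)) \<longlongrightarrow> 0) F"
    by simp
  from tendsto_mult_right_zero[OF this, of C] show ?thesis
    by (rule Lim_null_comparison[OF always_eventually[OF allI[OF bound]]])
qed

lemma has_vector_derivative_comp_cosh:
  fixes \<Phi> :: "real \<Rightarrow> complex"
  assumes "\<And>u. (\<Phi> has_vector_derivative \<Phi>' u) (at u)"
  shows "((\<lambda>s. \<Phi> (y * cosh (s / 2))) has_vector_derivative
    of_real (y * sinh (s / 2) / 2) * \<Phi>' (y * cosh (s / 2))) (at s)"
  by (rule has_vector_derivative_chain_real[OF _ assms]) (auto intro!: derivative_eq_intros)

text \<open>Writing \<open>sinh\<^sup>2\<close> as \<open>cosh\<^sup>2 - 1\<close> keeps the second derivative within the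
  family \<open>cosh_integrand\<close>.\<close>
lemma has_second_vector_derivative_comp_cosh:
  fixes \<Phi>' :: "real \<Rightarrow> complex"
  assumes "\<And>u. (\<Phi>' has_vector_derivative \<Phi>'' u) (at u)"
  shows "((\<lambda>s. of_real (y * sinh (s / 2) / 2) * \<Phi>' (y * cosh (s / 2))) has_vector_derivative
    of_real (y\<^sup>2 / 4) * (of_real ((cosh (s / 2))\<^sup>2 - 1) * \<Phi>'' (y * cosh (s / 2)))
    + of_real (y / 4) * (of_real (cosh (s / 2)) * \<Phi>' (y * cosh (s / 2)))) (at s)"
proof -
  have sinh_square: "complex_of_real ((cosh (s / 2))\<^sup>2 - 1) = (of_real (sinh (s / 2)))\<^sup>2"
    by (simp add: cosh_square_eq)
  have "((\<lambda>s. of_real (y * sinh (s / 2) / 2)) has_vector_derivative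
      complex_of_real (y * cosh (s / 2) / 4)) (at s)"
    by (rule has_vector_derivative_of_real) (auto intro!: derivative_eq_intros)
  from has_vector_derivative_mult[OF this has_vector_derivative_comp_cosh[OF assms]] show ?thesis
    unfolding sinh_square
    by (rule has_vector_derivative_eq_rhs) (simp add: power2_eq_square mult_ac)
qed

lemma exp_mult_sinh_comp_cosh_tendsto_0:
  fixes \<nu> :: complex
  assumes "gaussian_decay \<Phi>" "y > 0" "F \<in> {at_bot, at_top}"
  shows "((\<lambda>s. exp (\<nu> * of_real s) * (of_real (y * sinh (s / 2) / 2) * \<Phi> (y * cosh (s / 2))))
      \<longlongrightarrow> 0) F"
proof (rule Lim_null_comparison[OF always_eventually[OF allI]])
  show "norm (exp (\<nu> * of_real s) * (of_real (y * sinh (s / 2) / 2) * \<Phi> (y * cosh (s / 2))))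
      \<le> y / 2 * norm (cosh_integrand \<nu> 1 \<Phi> y s)" for s
    using \<open>y > 0\<close> mult_right_mono[OF abs_sinh_le_cosh[of "s / 2"],
        of "y * norm (exp (\<nu> * of_real s)) * norm (\<Phi> (y * cosh (s / 2)))"]
    by (simp add: cosh_integrand_def norm_mult abs_mult mult_ac)
  show "((\<lambda>s. y / 2 * norm (cosh_integrand \<nu> 1 \<Phi> y s)) \<longlongrightarrow> 0) F"
    by (intro tendsto_mult_right_zero tendsto_norm_zero cosh_integrand_tendsto_0[OF assms])
qed

lemma cosh_integral_by_parts:
  assumes \<Phi>: "\<And>u. (\<Phi> has_vector_derivative \<Phi>' u) (at u)"
      "\<And>u. (\<Phi>' has_vector_derivative \<Phi>'' u) (at u)"
      "continuous_on UNIV \<Phi>''"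
    and decay: "gaussian_decay \<Phi>" "gaussian_decay \<Phi>'" "gaussian_decay \<Phi>''" and y: "y > 0"
  shows "of_real (y\<^sup>2 / 4) * (cosh_integral \<nu> 2 \<Phi>'' y - cosh_integral \<nu> 0 \<Phi>'' y)
      + of_real (y / 4) * cosh_integral \<nu> 1 \<Phi>' y = \<nu>\<^sup>2 * cosh_integral \<nu> 0 \<Phi> y"
proof -
  let ?I = "\<lambda>k \<Phi>. cosh_integrand \<nu> k \<Phi> y"
  define G where "G = (\<lambda>s. \<Phi> (y * cosh (s / 2)))"
  define G'' where "G'' = (\<lambda>s.
    of_real (y\<^sup>2 / 4) * (of_real ((cosh (s / 2))\<^sup>2 - 1) * \<Phi>'' (y * cosh (s / 2)))
    + of_real (y / 4) * (of_real (cosh (s / 2)) * \<Phi>' (y * cosh (s / 2))))"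
  have cont: "continuous_on UNIV \<Phi>" "continuous_on UNIV \<Phi>'"
    by (rule continuous_on_if_has_vector_derivative, rule \<Phi>)+
  note int = integrable_cosh_integrand[OF _ _ y]
  have exp_G: "exp (\<nu> * of_real s) * G s = ?I 0 \<Phi> s" for s
    by (simp add: G_def cosh_integrand_def)
  have exp_G'': "exp (\<nu> * of_real s) * G'' s =
      of_real (y\<^sup>2 / 4) * (?I 2 \<Phi>'' s - ?I 0 \<Phi>'' s) + of_real (y / 4) * ?I 1 \<Phi>' s" for s
    by (simp add: G''_def cosh_integrand_def algebra_simps)
  have "(\<integral>s. exp (\<nu> * of_real s) * G'' s \<partial>lborel) = \<nu>\<^sup>2 * (\<integral>s. exp (\<nu> * of_real s) * G s \<partial>lborel)"
  proof (rule integral_exp_mult_second_derivative)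
    show "(G has_vector_derivative
        of_real (y * sinh (s / 2) / 2) * \<Phi>' (y * cosh (s / 2))) (at s)" for s
      unfolding G_def by (rule has_vector_derivative_comp_cosh[OF \<Phi>(1)])
    show "continuous_on UNIV G''"
      unfolding G''_def
      by (intro continuous_intros continuous_on_compose2[OF \<Phi>(3)]
        continuous_on_compose2[OF cont(2)]) auto
    show "integrable lborel (\<lambda>s. exp (\<nu> * of_real s) * G s)"
      unfolding exp_G by (rule int[OF cont(1) decay(1)])
    show "integrable lborel (\<lambda>s. exp (\<nu> * of_real s) * G'' s)"
      unfolding exp_G'' using int[OF cont(2) decay(2)] int[OF \<Phi>(3) decay(3)] by simp
    show "((\<lambda>s. exp (\<nu> * of_real s) * G s) \<longlongrightarrow> 0) F" if "F \<in> {at_bot, at_top}" for F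
      unfolding exp_G by (rule cosh_integrand_tendsto_0[OF decay(1) y that])
  qed (use has_second_vector_derivative_comp_cosh[OF \<Phi>(2)]
    exp_mult_sinh_comp_cosh_tendsto_0[OF decay(2) y] in
    \<open>simp_all add: G''_def\<close>)
  then show ?thesis
    unfolding exp_G exp_G'' using int[OF cont(2) decay(2)] int[OF \<Phi>(3) decay(3)]
    by (simp add: cosh_integral_def)
qed

lemma integrable_cosh_integrand_damped_D:
  "y > 0 \<Longrightarrow> integrable lborel (cosh_integrand \<nu> k (damped_D \<mu>) y)"
  by (intro integrable_cosh_integrand continuous_on_damped_D gaussian_decay_damped_D)

lemma cosh_integral_uminus: "cosh_integral \<nu> k (\<lambda>u. - \<Phi> u) y = - cosh_integral \<nu> k \<Phi> y"
  by (simp add: cosh_integral_def cosh_integrand_def)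

lemma cosh_integral_damped_D_deriv:
  assumes "y > 0"
  shows "(cosh_integral \<nu> k (damped_D \<mu>) has_vector_derivative
      - cosh_integral \<nu> (Suc k) (damped_D (\<mu> + 1)) y) (at y)"
  unfolding cosh_integral_uminus[symmetric] using assms
  by (intro cosh_integral_deriv damped_D_deriv)
     (auto simp: gaussian_decay_uminus intro!: gaussian_decay_damped_D
       continuous_intros continuous_on_damped_D)

lemma cosh_integral_damped_D_ode:
  assumes y: "y > 0"
  shows "of_real (y\<^sup>2) * cosh_integral \<nu> 2 (damped_D (\<mu> + 2)) y =
    (4 * \<nu>\<^sup>2 - of_real (y\<^sup>2) * (\<mu> + 1)) * cosh_integral \<nu> 0 (damped_D \<mu>) y
    + of_real (y + y ^ 3) * cosh_integral \<nu> 1 (damped_D (\<mu> + 1)) y"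
proof -
  let ?K = "\<lambda>k \<mu>. cosh_integral \<nu> k (damped_D \<mu>) y"
  have "(damped_D (\<mu> + 1) has_vector_derivative - damped_D (\<mu> + 2) u) (at u)" for u
    using damped_D_deriv[of "\<mu> + 1"] by (simp add: add.assoc)
  then have "((\<lambda>u. - damped_D (\<mu> + 1) u) has_vector_derivative damped_D (\<mu> + 2) u) (at u)" for u
    using has_vector_derivative_minus by fastforce
  then have by_parts: "of_real (y\<^sup>2 / 4) * (?K 2 (\<mu> + 2) - ?K 0 (\<mu> + 2))
      - of_real (y / 4) * ?K 1 (\<mu> + 1) = \<nu>\<^sup>2 * ?K 0 \<mu>"
    using cosh_integral_by_parts[OF damped_D_deriv, of \<mu> "damped_D (\<mu> + 2)" y \<nu>] y
    by (simp add: gaussian_decay_uminus gaussian_decay_damped_D continuous_on_damped_D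
      cosh_integral_uminus)
  have "cosh_integrand \<nu> 0 (damped_D (\<mu> + 2)) y =
      (\<lambda>s. of_real y * cosh_integrand \<nu> 1 (damped_D (\<mu> + 1)) y s
        - (\<mu> + 1) * cosh_integrand \<nu> 0 (damped_D \<mu>) y s)"
    by (simp add: fun_eq_iff cosh_integrand_def damped_D_recurrence algebra_simps)
  then have recurrence: "?K 0 (\<mu> + 2) = of_real y * ?K 1 (\<mu> + 1) - (\<mu> + 1) * ?K 0 \<mu>"
    using integrable_cosh_integrand_damped_D[OF y] by (simp add: cosh_integral_def)
  from arg_cong[OF by_parts, of "(*) 4"] show ?thesis
    unfolding recurrence by (simp add: algebra_simps power2_eq_square power3_eq_cube)
qed

section \<open>Laplace's method\<close>

text \<open>This is what the substitution \<open>s = t / y\<close> produces for \<open>\<Phi> u = exp (- u\<^sup>2 / 2) u\<^bsup>\<mu>\<^esup> R u\<close>: since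
  \<open>cosh\<^sup>2 = 1 + sinh\<^sup>2\<close>, the factors \<open>exp (y\<^sup>2 / 2)\<close> and \<open>exp (- (y cosh (s / 2))\<^sup>2 / 2)\<close> leave a Gaussian.\<close>
definition laplace_integrand ::
    "complex \<Rightarrow> complex \<Rightarrow> (real \<Rightarrow> complex) \<Rightarrow> real \<Rightarrow> real \<Rightarrow> complex" where
  "laplace_integrand \<nu> \<mu> R y t = exp (\<nu> * of_real (t / y)) * of_real (cosh (t / y / 2)) powr \<mu>
    * R (y * cosh (t / y / 2)) * of_real (exp (- (y * sinh (t / y / 2))\<^sup>2 / 2))"

lemma scaled_cosh_integrand_eq_laplace_integrand:
  assumes y: "y > 0" and R: "R = (\<lambda>u. \<Phi> u / (of_real (exp (- u\<^sup>2 / 2)) * of_real u powr \<mu>))"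
  shows "of_real y powr (1 - \<mu>) * of_real (exp (y\<^sup>2 / 2))
      * ((1 / y) *\<^sub>R cosh_integrand \<nu> 0 \<Phi> y (t / y))
    = laplace_integrand \<nu> \<mu> R y t"
proof -
  let ?c = "cosh (t / y / 2)"
  have \<Phi>: "\<Phi> (y * ?c) = R (y * ?c) * of_real (exp (- (y * ?c)\<^sup>2 / 2)) * of_real (y * ?c) powr \<mu>"
    using y by (simp add: R del: of_real_exp)
  have powr_mult: "complex_of_real (y * ?c) powr \<mu> = of_real y powr \<mu> * of_real ?c powr \<mu>"
    unfolding of_real_mult using y by (intro powr_times_real) auto
  have powr_cancel: "complex_of_real y powr (1 - \<mu>) * of_real y powr \<mu> = of_real y"
    using y by (simp flip: powr_add)
  have exp_mult: "exp (y\<^sup>2 / 2) * exp (- (y * ?c)\<^sup>2 / 2) = exp (- (y * sinh (t / y / 2))\<^sup>2 / 2)"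
    by (simp add: cosh_square_eq power_mult_distrib field_simps flip: exp_add)
  have "of_real y powr (1 - \<mu>) * of_real (exp (y\<^sup>2 / 2))
      * ((1 / y) *\<^sub>R cosh_integrand \<nu> 0 \<Phi> y (t / y)) =
      (of_real y powr (1 - \<mu>) * of_real y powr \<mu>) * of_real (1 / y)
        * of_real (exp (y\<^sup>2 / 2) * exp (- (y * ?c)\<^sup>2 / 2))
      * (exp (\<nu> * of_real (t / y)) * of_real ?c powr \<mu> * R (y * ?c))"
    unfolding cosh_integrand_def \<Phi> powr_mult scaleR_conv_of_real
      of_real_mult[of "exp (y\<^sup>2 / 2)"] power_0 of_real_1
    by (simp only: mult_ac mult_1_right mult_1)
  then show ?thesis
    unfolding powr_cancel exp_mult laplace_integrand_def using y by (simp del: of_real_exp)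
qed

lemma norm_laplace_integrand_le:
  assumes y: "y \<ge> N" "y \<ge> 1" and R: "\<And>u. u \<ge> N \<Longrightarrow> norm (R u) \<le> B"
  shows "norm (laplace_integrand \<nu> \<mu> R y t) \<le> B * exp ((norm \<nu> + \<bar>Re \<mu>\<bar>) * \<bar>t\<bar> - 1 / 8 * t\<^sup>2)"
proof -
  let ?c = "cosh (t / y / 2)"
  have t_div_y: "\<bar>t / y\<bar> \<le> \<bar>t\<bar>"
    using y mult_left_mono[of 1 y "\<bar>t\<bar>"] by (simp add: field_simps)
  have "norm \<nu> * \<bar>t / y\<bar> \<le> norm \<nu> * \<bar>t\<bar>"
    using t_div_y by (rule mult_left_mono) simp
  then have exp_le: "norm (exp (\<nu> * of_real (t / y))) \<le> exp (norm \<nu> * \<bar>t\<bar>)"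
    using norm_exp_mult_of_real_le[of \<nu> "t / y"] by (meson exp_le_cancel_iff order_trans)
  have "?c powr Re \<mu> \<le> ?c powr \<bar>Re \<mu>\<bar>"
    by (intro powr_mono) (auto simp: cosh_real_ge_1)
  also have "\<dots> \<le> exp \<bar>t\<bar> powr \<bar>Re \<mu>\<bar>"
    using cosh_le_exp_abs[of "t / y / 2"] t_div_y
    by (intro powr_mono2 order_trans[OF cosh_le_exp_abs]) auto
  finally have powr_le: "norm (complex_of_real ?c powr \<mu>) \<le> exp (\<bar>Re \<mu>\<bar> * \<bar>t\<bar>)"
    by (simp add: norm_powr_real_powr powr_def mult.commute)
  have "y \<le> y * ?c"
    using y mult_left_mono[OF cosh_real_ge_1[of "t / y / 2"], of y] by linarith
  then have R_le: "norm (R (y * ?c)) \<le> B"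
    by (intro R order_trans[OF y(1)])
  have "t\<^sup>2 / 8 = y\<^sup>2 * (t / y / 2)\<^sup>2 / 2"
    using y by (simp add: power_divide)
  also have "\<dots> \<le> (y * sinh (t / y / 2))\<^sup>2 / 2"
    unfolding power_mult_distrib
    by (intro divide_right_mono mult_left_mono square_le_sinh_square) auto
  finally have gauss_le: "norm (complex_of_real (exp (- (y * sinh (t / y / 2))\<^sup>2 / 2)))
      \<le> exp (- (1 / 8 * t\<^sup>2))"
    by (simp del: of_real_exp)
  have "0 \<le> B"
    using R_le norm_ge_zero order_trans by blast
  then have "norm (laplace_integrand \<nu> \<mu> R y t)
      \<le> exp (norm \<nu> * \<bar>t\<bar>) * exp (\<bar>Re \<mu>\<bar> * \<bar>t\<bar>) * B * exp (- (1 / 8 * t\<^sup>2))"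
    unfolding laplace_integrand_def norm_mult by (intro mult_mono exp_le powr_le R_le gauss_le) auto
  also have "\<dots> = B * exp (norm \<nu> * \<bar>t\<bar> + \<bar>Re \<mu>\<bar> * \<bar>t\<bar> + - (1 / 8 * t\<^sup>2))"
    by (simp only: exp_add mult_ac)
  finally show ?thesis
    by (simp add: distrib_right)
qed

lemma tendsto_mult_sinh_divide: "((\<lambda>y. y * sinh (a / y)) \<longlongrightarrow> a) at_top" for a :: real
proof -
  consider "a = 0" | "a > 0" | "a < 0" by linarith
  then show ?thesis
    unfolding sinh_field_def by cases (simp, real_asymp+)
qed

lemma laplace_integrand_tendsto:
  assumes R: "(R \<longlongrightarrow> l) at_top"
  shows "((\<lambda>y. laplace_integrand \<nu> \<mu> R y t) \<longlongrightarrow> l * of_real (exp (- t\<^sup>2 / 8))) at_top"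
proof -
  have t_div_y: "((\<lambda>y. t / y) \<longlongrightarrow> 0) at_top"
    by (rule real_tendsto_divide_at_top[OF tendsto_const filterlim_ident])
  have exp: "((\<lambda>y. exp (\<nu> * complex_of_real (t / y))) \<longlongrightarrow> exp (\<nu> * of_real 0)) at_top"
    by (intro tendsto_intros t_div_y)
  have "((\<lambda>y. cosh (t / y / 2)) \<longlongrightarrow> cosh (0 / 2)) at_top"
    by (intro tendsto_intros t_div_y) auto
  then have powr: "((\<lambda>y. complex_of_real (cosh (t / y / 2)) powr \<mu>)
      \<longlongrightarrow> of_real (cosh (0 / 2)) powr \<mu>) at_top"
    by (intro tendsto_powr_complex tendsto_of_real tendsto_const) auto
  have "eventually (\<lambda>y. y \<le> y * cosh (t / y / 2)) at_top"
    using eventually_ge_at_top[of 0]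
    by eventually_elim (use mult_left_mono[OF cosh_real_ge_1] in fastforce)
  then have "filterlim (\<lambda>y::real. y * cosh (t / y / 2)) at_top at_top"
    by (rule filterlim_at_top_mono[OF filterlim_ident])
  then have R_comp: "((\<lambda>y. R (y * cosh (t / y / 2))) \<longlongrightarrow> l) at_top"
    by (rule filterlim_compose[OF R])
  have "((\<lambda>y. y * sinh (t / y / 2)) \<longlongrightarrow> t / 2) at_top"
    using tendsto_mult_sinh_divide[of "t / 2"] by (simp add: mult.commute)
  then have gauss: "((\<lambda>y. complex_of_real (exp (- (y * sinh (t / y / 2))\<^sup>2 / 2)))
      \<longlongrightarrow> of_real (exp (- (t / 2)\<^sup>2 / 2))) at_top"
    by (intro tendsto_intros) auto
  show ?thesis
    unfolding laplace_integrand_def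
    using tendsto_mult[OF tendsto_mult[OF tendsto_mult[OF exp powr] R_comp] gauss]
    by (simp add: power_divide del: of_real_exp)
qed

lemma eventually_laplace_integrand_dominated:
  assumes R: "(R \<longlongrightarrow> l) at_top"
  shows "eventually (\<lambda>y. \<forall>t. norm (laplace_integrand \<nu> \<mu> R y t)
    \<le> (norm l + 1) * exp ((norm \<nu> + \<bar>Re \<mu>\<bar>) * \<bar>t\<bar> - 1 / 8 * t\<^sup>2)) at_top"
proof -
  have "eventually (\<lambda>u. norm (R u) < norm l + 1) at_top"
    by (rule order_tendstoD(2)[OF tendsto_norm[OF R]]) simp
  then obtain N where N: "\<And>u. u \<ge> N \<Longrightarrow> norm (R u) \<le> norm l + 1"
    by (auto simp: eventually_at_top_linorder intro: less_imp_le)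
  show ?thesis
    using eventually_ge_at_top[of N] eventually_ge_at_top[of 1]
    by eventually_elim (intro allI norm_laplace_integrand_le N)
qed

lemma cosh_integral_rescale:
  assumes "y > 0"
  shows "cosh_integral \<nu> k \<Phi> y = (1 / y) *\<^sub>R (\<integral>t. cosh_integrand \<nu> k \<Phi> y (t / y) \<partial>lborel)"
  unfolding cosh_integral_def
  using assms by (subst lborel_integral_real_affine[where c = "1 / y" and t = 0]) auto

lemma cosh_integral_asymp:
  assumes cont: "continuous_on UNIV \<Phi>"
    and asymp: "((\<lambda>u. \<Phi> u / (of_real (exp (- u\<^sup>2 / 2)) * of_real u powr \<mu>)) \<longlongrightarrow> l) at_top"
  shows "((\<lambda>y. of_real y powr (1 - \<mu>) * of_real (exp (y\<^sup>2 / 2)) * cosh_integral \<nu> 0 \<Phi> y)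
    \<longlongrightarrow> l * of_real (sqrt (8 * pi))) at_top"
proof -
  define R where "R = (\<lambda>u. \<Phi> u / (of_real (exp (- u\<^sup>2 / 2)) * of_real u powr \<mu>))"
  define h where "h = (\<lambda>y t. of_real y powr (1 - \<mu>) * of_real (exp (y\<^sup>2 / 2))
    * ((1 / y) *\<^sub>R cosh_integrand \<nu> 0 \<Phi> y (t / y)))"
  have h_eq: "h y t = laplace_integrand \<nu> \<mu> R y t" if "y > 0" for y t
    unfolding h_def by (rule scaled_cosh_integrand_eq_laplace_integrand[OF that R_def])
  note R = asymp[folded R_def]
  let ?w = "\<lambda>t. (norm l + 1) * exp ((norm \<nu> + \<bar>Re \<mu>\<bar>) * \<bar>t\<bar> - 1 / 8 * t\<^sup>2)"
  have "((\<lambda>y. \<integral>t. h y t \<partial>lborel) \<longlongrightarrow> (\<integral>t. l * of_real (exp (- t\<^sup>2 / 8)) \<partial>lborel)) at_top"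
  proof (rule integral_dominated_convergence_at_top[where w = ?w])
    show "(\<lambda>t. l * of_real (exp (- t\<^sup>2 / 8))) \<in> borel_measurable lborel" by measurable
    show "h y \<in> borel_measurable lborel" for y
      unfolding h_def
      using borel_measurable_continuous_onI[OF continuous_on_cosh_integrand[OF
          cont, of UNIV \<nu> 0 y]]
      by measurable
    show "integrable lborel ?w"
      by (intro integrable_mult_right integrable_exp_abs_minus_square) simp
    show "eventually (\<lambda>y. AE t in lborel. norm (h y t) \<le> ?w t) at_top"
      using eventually_gt_at_top[of 0] eventually_laplace_integrand_dominated[OF R, of \<nu> \<mu>]
      by eventually_elim (intro AE_I2, simp only: h_eq)
    show "AE t in lborel. ((\<lambda>y. h y t) \<longlongrightarrow> l * of_real (exp (- t\<^sup>2 / 8))) at_top"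
    proof (intro AE_I2 Lim_transform_eventually[OF laplace_integrand_tendsto[OF R]])
      show "eventually (\<lambda>y. laplace_integrand \<nu> \<mu> R y t = h y t) at_top" for t
        using eventually_gt_at_top[of 0] by eventually_elim (simp add: h_eq)
    qed
  qed
  moreover have "(\<integral>t. l * of_real (exp (- t\<^sup>2 / 8)) \<partial>lborel) = l * of_real (sqrt (8 * pi))"
    using integral_exp_minus_square[of 2] by (simp add: integral_complex_of_real del: of_real_exp)
  moreover have "eventually (\<lambda>y. (\<integral>t. h y t \<partial>lborel) =
      of_real y powr (1 - \<mu>) * of_real (exp (y\<^sup>2 / 2)) * cosh_integral \<nu> 0 \<Phi> y) at_top"
    using eventually_gt_at_top[of 0]
    by eventually_elim
       (simp only: h_def cosh_integral_rescale integral_mult_right_zero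
         Bochner_Integration.integral_scaleR_right)
  ultimately show ?thesis
    by (auto intro: Lim_transform_eventually)
qed

section \<open>Whittaker's function\<close>

abbreviation whittaker_potential :: "complex \<Rightarrow> complex \<Rightarrow> real \<Rightarrow> complex" where
  "whittaker_potential \<kappa> \<mu> z \<equiv> 1/4 - \<kappa> / of_real z + (\<mu>\<^sup>2 - 1/4) / (of_real z)\<^sup>2"

definition whittaker_gauge :: "complex \<Rightarrow> real \<Rightarrow> complex" where
  "whittaker_gauge \<kappa> z = exp (- of_real z / 2) * of_real z powr \<kappa>"

lemma whittaker_gauge_tendsto_0: "(whittaker_gauge \<kappa> \<longlongrightarrow> 0) at_top"
proof (rule tendsto_norm_zero_cancel, rule Lim_transform_eventually)
  show "((\<lambda>z. exp (- z / 2) * z powr Re \<kappa>) \<longlongrightarrow> 0) at_top" by real_asymp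
  show "eventually (\<lambda>z. exp (- z / 2) * z powr Re \<kappa> = norm (whittaker_gauge \<kappa> z)) at_top"
    using eventually_gt_at_top[of 0]
    by eventually_elim (simp add: whittaker_gauge_def norm_mult norm_powr_real_powr)
qed

lemma whittaker_potential_tendsto: "(whittaker_potential \<kappa> \<mu> \<longlongrightarrow> 1/4) at_top"
proof -
  have "((\<lambda>z::real. 1 / z) \<longlongrightarrow> 0) at_top" by real_asymp
  then have inv: "((\<lambda>z::real. complex_of_real (1 / z)) \<longlongrightarrow> of_real 0) at_top"
    by (rule tendsto_of_real)
  have "((\<lambda>z::real. 1/4 - \<kappa> * of_real (1 / z) + (\<mu>\<^sup>2 - 1/4) * (of_real (1 / z))\<^sup>2) \<longlongrightarrow>
      1/4 - \<kappa> * of_real 0 + (\<mu>\<^sup>2 - 1/4) * (of_real 0)\<^sup>2) at_top"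
    by (intro tendsto_intros inv)
  then show ?thesis by (simp add: power_divide)
qed

lemma whittaker_W_eqI:
  assumes sol: "ode2_solution_on {0<..} (whittaker_potential \<kappa> \<mu>) f f'"
    and asymp: "((\<lambda>z. f z / whittaker_gauge \<kappa> z) \<longlongrightarrow> 1) at_top" and "z > 0"
  shows "whittaker_W \<kappa> \<mu> z = f z"
proof -
  let ?P = "\<lambda>f. (\<forall>z\<le>0. f z = 0) \<and> (\<exists>f'. ode2_solution_on {0<..} (whittaker_potential \<kappa> \<mu>) f f') \<and>
      ((\<lambda>z. f z / whittaker_gauge \<kappa> z) \<longlongrightarrow> 1) at_top"
  define f\<^sub>0 where "f\<^sub>0 = (\<lambda>z. if z \<le> 0 then 0 else f z)"
  have sol\<^sub>0: "ode2_solution_on {0<..} (whittaker_potential \<kappa> \<mu>) f\<^sub>0 f'"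
    by (rule ode2_solution_on_cong[OF sol]) (auto simp: f\<^sub>0_def)
  have asymp\<^sub>0: "((\<lambda>z. f\<^sub>0 z / whittaker_gauge \<kappa> z) \<longlongrightarrow> 1) at_top"
    using asymp
  proof (rule Lim_transform_eventually)
    show "eventually (\<lambda>z. f z / whittaker_gauge \<kappa> z = f\<^sub>0 z / whittaker_gauge \<kappa> z) at_top"
      using eventually_gt_at_top[of 0] by eventually_elim (simp add: f\<^sub>0_def)
  qed
  have "whittaker_W \<kappa> \<mu> = (THE f. ?P f)"
    unfolding whittaker_W_def ode2_solution_on_def whittaker_gauge_def by (simp add: Ball_def)
  also have "\<dots> = f\<^sub>0"
  proof (rule the_equality)
    show "?P f\<^sub>0"
      using sol\<^sub>0 asymp\<^sub>0 by (auto simp: f\<^sub>0_def)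
  next
    fix h assume h: "?P h"
    then obtain h' where sol_h: "ode2_solution_on {0<..} (whittaker_potential \<kappa> \<mu>) h h'" by blast
    have "h z = f\<^sub>0 z" if "z > 0" for z
    proof (rule recessive_solution_unique[OF sol_h sol\<^sub>0, where \<phi> = "whittaker_gauge \<kappa>"])
      show "continuous_on {0<..} (whittaker_potential \<kappa> \<mu>)" by (intro continuous_intros) auto
      show "((\<lambda>z. whittaker_potential \<kappa> \<mu> z * whittaker_gauge \<kappa> z) \<longlongrightarrow> 0) at_top"
        using tendsto_mult[OF whittaker_potential_tendsto whittaker_gauge_tendsto_0] by simp
      show "eventually (\<lambda>z::real. z \<in> {0<..}) at_top"
        using eventually_gt_at_top[of 0] by simp
    qed (use h asymp\<^sub>0 that in \<open>auto simp: whittaker_gauge_tendsto_0\<close>)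
    with h show "h = f\<^sub>0"
      by (metis ext f\<^sub>0_def not_le)
  qed
  finally show ?thesis
    using \<open>z > 0\<close> by (simp add: f\<^sub>0_def)
qed

definition whittaker_factor :: "complex \<Rightarrow> real \<Rightarrow> complex" where
  "whittaker_factor \<alpha> z = 2 powr (- 1 - \<alpha>) / of_real (sqrt pi) * of_real (sqrt z * exp (z / 2))"

lemma whittaker_factor_deriv:
  assumes "z > 0"
  shows "(whittaker_factor \<alpha> has_vector_derivative
      of_real (1 / (2 * z) + 1 / 2) * whittaker_factor \<alpha> z) (at z)"
proof -
  have "sqrt z * sqrt z = z" using assms by simp
  then have "((\<lambda>z. sqrt z * exp (z / 2)) has_real_derivative
      (1 / (2 * z) + 1 / 2) * (sqrt z * exp (z / 2))) (at z)"
    using assms by (auto intro!: derivative_eq_intros simp: field_simps)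
  from has_vector_derivative_mult_right[OF has_vector_derivative_of_real[OF this]] show ?thesis
    unfolding whittaker_factor_def[abs_def]
    by (rule has_vector_derivative_eq_rhs) (simp only: of_real_mult mult_ac)
qed

lemma whittaker_factor_div_gauge:
  assumes "z > 0"
  shows "whittaker_factor \<alpha> z / whittaker_gauge \<alpha> z =
    of_real (1 / sqrt (8 * pi)) * (of_real (sqrt (2 * z)) powr (1 - 2 * \<alpha>)
      * of_real (exp ((sqrt (2 * z))\<^sup>2 / 2)))"
proof -
  let ?y = "complex_of_real (sqrt (2 * z))"
  have "?y powr (2 * \<alpha>) = (?y * ?y) powr \<alpha>"
    using assms by (subst powr_times_real) (auto simp flip: powr_add)
  also have "?y * ?y = 2 * of_real z"
    using assms unfolding of_real_mult[symmetric] by simp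
  also have "(2 * complex_of_real z) powr \<alpha> = 2 powr \<alpha> * of_real z powr \<alpha>"
    using assms by (intro powr_times_real) auto
  finally have y_powr: "?y powr (1 - 2 * \<alpha>) =
      of_real (sqrt 2 * sqrt z) / (2 powr \<alpha> * of_real z powr \<alpha>)"
    using assms by (simp add: powr_diff real_sqrt_mult)
  have "sqrt (8 * pi) = sqrt (2\<^sup>2 * 2 * pi)" by simp
  then have sqrt_8_pi: "sqrt (8 * pi) = 2 * sqrt 2 * sqrt pi"
    by (simp only: real_sqrt_mult real_sqrt_abs abs_numeral)
  have two_powr: "(2::complex) powr (- 1 - \<alpha>) = 1 / (2 * 2 powr \<alpha>)"
    using powr_diff[of 2 "- 1" \<alpha>] by (simp add: powr_minus)
  have exp_half: "complex_of_real (exp (z / 2)) = of_real (exp z) * exp (- of_real z / 2)"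
    by (simp flip: exp_of_real exp_add)
  have y_square: "(sqrt (2 * z))\<^sup>2 / 2 = z"
    using assms by simp
  show ?thesis
    unfolding whittaker_factor_def whittaker_gauge_def y_powr y_square
      sqrt_8_pi two_powr of_real_mult exp_half
    by (simp add: field_simps del: of_real_exp)
qed

lemma DERIV_sqrt_double:
  assumes "z > 0"
  shows "((\<lambda>z. sqrt (2 * z)) has_real_derivative 1 / sqrt (2 * z)) (at z)"
  using assms by (auto intro!: derivative_eq_intros simp: inverse_eq_divide)

lemma cosh_integral_damped_D_sqrt_deriv:
  assumes "z > 0"
  shows "((\<lambda>z. cosh_integral \<nu> k (damped_D \<mu>) (sqrt (2 * z))) has_vector_derivative
    of_real (1 / sqrt (2 * z)) * - cosh_integral \<nu> (Suc k) (damped_D (\<mu> + 1)) (sqrt (2 * z))) (at z)"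
  by (rule has_vector_derivative_chain_real[OF DERIV_sqrt_double cosh_integral_damped_D_deriv])
    (use assms in simp_all)

lemma cosh_integral_damped_D_sqrt_deriv2:
  fixes \<alpha> \<nu> :: complex
  defines "J \<equiv> \<lambda>z. cosh_integral \<nu> 0 (damped_D (2 * \<alpha>)) (sqrt (2 * z))"
    and "J' \<equiv> \<lambda>z. of_real (1 / sqrt (2 * z))
        * - cosh_integral \<nu> 1 (damped_D (2 * \<alpha> + 1)) (sqrt (2 * z))"
  assumes "z > 0"
  shows "(J' has_vector_derivative
    (\<nu>\<^sup>2 / (of_real z)\<^sup>2 - (\<alpha> + 1/2) / of_real z) * J z
      - 2 * of_real (1 / (2 * z) + 1 / 2) * J' z) (at z)"
proof -
  let ?K = "\<lambda>k \<mu>. cosh_integral \<nu> k (damped_D \<mu>)"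
  define y where "y = sqrt (2 * z)"
  have y: "y > 0" "y * y = 2 * z"
    using \<open>z > 0\<close> by (auto simp: y_def)
  have "((\<lambda>z. 1 / sqrt (2 * z)) has_real_derivative - 1 / y ^ 3) (at z)"
    by (rule DERIV_cong[OF DERIV_divide[OF DERIV_const DERIV_sqrt_double[OF \<open>z > 0\<close>]]])
       (use y(1) in \<open>simp_all add: y_def power3_eq_cube\<close>)
  then have inverse_sqrt: "((\<lambda>z. complex_of_real (1 / sqrt (2 * z))) has_vector_derivative
      of_real (- 1 / y ^ 3)) (at z)"
    by (rule has_vector_derivative_of_real)
  have "((\<lambda>z. - ?K 1 (2 * \<alpha> + 1) (sqrt (2 * z))) has_vector_derivative
      of_real (1 / y) * ?K 2 (2 * \<alpha> + 2) y) (at z)"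
    using has_vector_derivative_minus[OF
        cosh_integral_damped_D_sqrt_deriv[OF \<open>z > 0\<close>, of \<nu> 1 "2 * \<alpha> + 1"]]
    by (simp add: y_def add.assoc numeral_2_eq_2)
  from has_vector_derivative_mult[OF inverse_sqrt this] show ?thesis
    unfolding J'_def
  proof (rule has_vector_derivative_eq_rhs)
    have z: "complex_of_real z = of_real y * of_real y / 2"
      unfolding of_real_mult[symmetric] y(2) by simp
    have nonzero: "complex_of_real y \<noteq> 0" using y(1) by simp
    have K2: "?K 2 (2 * \<alpha> + 2) y = ((4 * \<nu>\<^sup>2 - of_real y * of_real y * (2 * \<alpha> + 1)) * ?K 0 (2 * \<alpha>) y
        + (of_real y + of_real y * of_real y * of_real y) * ?K 1 (2 * \<alpha> + 1) y)
        / (of_real y * of_real y)"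
      using cosh_integral_damped_D_ode[OF y(1), of \<nu> "2 * \<alpha>"] nonzero
      by (simp add: field_simps power2_eq_square power3_eq_cube)
    show "of_real (1 / sqrt (2 * z)) * (of_real (1 / y) * ?K 2 (2 * \<alpha> + 2) y)
        + of_real (- 1 / y ^ 3) * - ?K 1 (2 * \<alpha> + 1) (sqrt (2 * z)) =
      (\<nu>\<^sup>2 / (of_real z)\<^sup>2 - (\<alpha> + 1/2) / of_real z) * J z
        - 2 * of_real (1 / (2 * z) + 1 / 2)
          * (of_real (1 / sqrt (2 * z)) * - ?K 1 (2 * \<alpha> + 1) (sqrt (2 * z)))"
      using nonzero unfolding K2 J_def y_def[symmetric] of_real_add of_real_divide of_real_mult z
      by (simp add: field_simps power2_eq_square power3_eq_cube)
  qed
qed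

lemma whittaker_factor_mult_cosh_integral_asymp:
  "((\<lambda>z. whittaker_factor \<alpha> z
      * cosh_integral \<nu> 0 (damped_D (2 * \<alpha>)) (sqrt (2 * z)) / whittaker_gauge \<alpha> z) \<longlongrightarrow> 1) at_top"
proof -
  let ?h = "\<lambda>y. of_real y powr (1 - 2 * \<alpha>) * of_real (exp (y\<^sup>2 / 2))
      * cosh_integral \<nu> 0 (damped_D (2 * \<alpha>)) y"
  have "(?h \<longlongrightarrow> 1 * of_real (sqrt (8 * pi))) at_top"
    by (rule cosh_integral_asymp[OF continuous_on_damped_D damped_D_asymp])
  moreover have "filterlim (\<lambda>z::real. sqrt (2 * z)) at_top at_top" by real_asymp
  ultimately have "((\<lambda>z. ?h (sqrt (2 * z))) \<longlongrightarrow> 1 * of_real (sqrt (8 * pi))) at_top"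
    by (rule filterlim_compose)
  from tendsto_mult[OF tendsto_const[of "complex_of_real (1 / sqrt (8 * pi))"] this]
  have "((\<lambda>z. of_real (1 / sqrt (8 * pi)) * ?h (sqrt (2 * z))) \<longlongrightarrow> 1) at_top"
    by (simp flip: of_real_mult)
  then show ?thesis
  proof (rule Lim_transform_eventually)
    show "eventually (\<lambda>z. of_real (1 / sqrt (8 * pi)) * ?h (sqrt (2 * z)) =
        whittaker_factor \<alpha> z * cosh_integral \<nu> 0 (damped_D (2 * \<alpha>)) (sqrt (2 * z))
          / whittaker_gauge \<alpha> z) at_top"
      using eventually_gt_at_top[of 0]
      by eventually_elim
         (simp only: times_divide_eq_left[symmetric] whittaker_factor_div_gauge mult.assoc)
  qed
qed

lemma whittaker_W_eq_cosh_integral: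
  assumes "z > 0"
  shows "whittaker_W \<alpha> \<nu> z =
      whittaker_factor \<alpha> z * cosh_integral \<nu> 0 (damped_D (2 * \<alpha>)) (sqrt (2 * z))"
proof (rule whittaker_W_eqI[OF _ whittaker_factor_mult_cosh_integral_asymp assms])
  let ?b = "\<lambda>z::real. complex_of_real (1 / (2 * z) + 1 / 2)"
  let ?J = "\<lambda>z. cosh_integral \<nu> 0 (damped_D (2 * \<alpha>)) (sqrt (2 * z))"
  let ?J' = "\<lambda>z. of_real (1 / sqrt (2 * z))
      * - cosh_integral \<nu> 1 (damped_D (2 * \<alpha> + 1)) (sqrt (2 * z))"
  have "(\<nu>\<^sup>2 / (of_real z)\<^sup>2 - (\<alpha> + 1/2) / of_real z) + (?b z)\<^sup>2 + of_real (- 1 / (2 * z\<^sup>2)) =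
      whittaker_potential \<alpha> \<nu> z" for z :: real
    by (cases "z = 0") (simp_all add: field_simps power2_eq_square)
  moreover have "ode2_solution_on {0<..}
      (\<lambda>z. (\<nu>\<^sup>2 / (of_real z)\<^sup>2 - (\<alpha> + 1/2) / of_real z) + (?b z)\<^sup>2 + of_real (- 1 / (2 * z\<^sup>2)))
      (\<lambda>z. whittaker_factor \<alpha> z * ?J z) (\<lambda>z. whittaker_factor \<alpha> z * (?b z * ?J z + ?J' z))"
  proof (rule ode2_solution_on_liouville)
    fix z :: real assume z: "z \<in> {0<..}"
    then show "(?J has_vector_derivative ?J' z) (at z)"
      using cosh_integral_damped_D_sqrt_deriv[of z \<nu> 0 "2 * \<alpha>"] by simp
    show "(?b has_vector_derivative of_real (- 1 / (2 * z\<^sup>2))) (at z)"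
      using z by (intro has_vector_derivative_of_real)
        (auto intro!: derivative_eq_intros simp: field_simps power2_eq_square)
  qed (simp_all only: greaterThan_iff cosh_integral_damped_D_sqrt_deriv2 whittaker_factor_deriv)
  ultimately show "ode2_solution_on {0<..} (whittaker_potential \<alpha> \<nu>)
      (\<lambda>z. whittaker_factor \<alpha> z * ?J z) (\<lambda>z. whittaker_factor \<alpha> z * (?b z * ?J z + ?J' z))"
    by (simp only:)
qed

section \<open>The integral representation\<close>

definition eta_factor :: "complex \<Rightarrow> real \<Rightarrow> complex" where
  "eta_factor \<alpha> x = of_real (2 powr (- 3 / 2) * pi powr (- 1 / 2)) * of_real x powr (- 1 + 2 * \<alpha>)
    * of_real (exp (1 / (2 * x\<^sup>2)))"

lemma exp_mult_eta:
  "exp (\<nu> * of_real s) * eta \<alpha> x s =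
    eta_factor \<alpha> x * cosh_integrand \<nu> 0 (damped_D (2 * \<alpha>)) (1 / x) s"
proof -
  have "exp (1 / (2 * x\<^sup>2) - (cosh (s / 2))\<^sup>2 / (4 * x\<^sup>2)) =
      exp (1 / (2 * x\<^sup>2)) * exp (- (1 / x * cosh (s / 2))\<^sup>2 / 4)"
    by (simp add: power_divide flip: exp_add)
  then show ?thesis
    unfolding eta_def eta_factor_def cosh_integrand_def damped_D_def
    by (simp add: mult_ac del: of_real_exp exp_of_real)
qed

lemma eta_factor_eq_whittaker_factor:
  assumes "x > 0"
  shows "eta_factor \<alpha> x =
      2 powr \<alpha> * of_real x powr (2 * \<alpha>) * of_real (exp (1 / (4 * x\<^sup>2)))
        * whittaker_factor \<alpha> (1 / (2 * x\<^sup>2))"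
proof -
  have sqrt: "sqrt (1 / (2 * x\<^sup>2)) = 1 / (sqrt 2 * x)"
    using assms by (simp add: real_sqrt_divide real_sqrt_mult)
  have "2 powr (- 3 / 2) = 2 powr (- 1) * (2::real) powr (- (1 / 2))"
    by (subst powr_add[symmetric]) simp
  then have two_powr: "2 powr (- 3 / 2) = 1 / (2 * sqrt 2)"
    by (simp add: powr_minus powr_half_sqrt field_simps)
  have pi_powr: "pi powr (- 1 / 2) = 1 / sqrt pi"
    using powr_minus_divide[of pi "1 / 2"] by (simp add: powr_half_sqrt)
  have two_powr_mult: "(2::complex) powr \<alpha> * 2 powr (- 1 - \<alpha>) = 1 / 2"
    by (simp flip: powr_add add: powr_minus_divide)
  have x_powr: "complex_of_real x powr (- 1 + 2 * \<alpha>) = of_real x powr (2 * \<alpha>) / of_real x"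
    using assms powr_diff[of "complex_of_real x" "2 * \<alpha>" 1] by simp
  have exp_mult: "exp (1 / (2 * x\<^sup>2)) = exp (1 / (4 * x\<^sup>2)) * exp (1 / (2 * x\<^sup>2) / 2)"
    by (simp flip: exp_add)
  have "2 powr \<alpha> * of_real x powr (2 * \<alpha>) * of_real (exp (1 / (4 * x\<^sup>2)))
      * whittaker_factor \<alpha> (1 / (2 * x\<^sup>2)) =
      (2 powr \<alpha> * 2 powr (- 1 - \<alpha>)) * of_real x powr (2 * \<alpha>)
        * of_real (1 / sqrt pi) * of_real (1 / (sqrt 2 * x))
      * of_real (exp (1 / (4 * x\<^sup>2)) * exp (1 / (2 * x\<^sup>2) / 2))"
    unfolding whittaker_factor_def sqrt by (simp add: mult_ac del: of_real_exp exp_of_real)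
  then show ?thesis
    unfolding eta_factor_def two_powr pi_powr two_powr_mult x_powr exp_mult[symmetric]
    by (simp add: mult_ac del: of_real_exp exp_of_real)
qed

lemma boldW_eq_cosh_integral:
  assumes "x > 0"
  shows "boldW \<alpha> \<nu> x = eta_factor \<alpha> x * cosh_integral \<nu> 0 (damped_D (2 * \<alpha>)) (1 / x)"
proof -
  have "sqrt (2 * (1 / (2 * x\<^sup>2))) = 1 / x"
    using assms by (simp add: real_sqrt_divide)
  then show ?thesis
    using assms whittaker_W_eq_cosh_integral[of "1 / (2 * x\<^sup>2)" \<alpha> \<nu>]
    by (simp only: boldW_def eta_factor_eq_whittaker_factor) (simp add: mult.assoc)
qed

lemma eta_minus: "eta \<alpha> x (- s) = eta \<alpha> x s"
  by (simp add: eta_def)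

theorem mainTheorem2:
  fixes \<alpha> \<nu> :: complex and x :: real
  assumes "x > 0"
  shows "integrable lborel (\<lambda>s. exp (\<nu> * of_real s) * eta \<alpha> x s)
    \<and> set_integrable lborel {0..} (\<lambda>s. cosh (\<nu> * of_real s) * eta \<alpha> x s)
    \<and> boldW \<alpha> \<nu> x = (\<integral>s. exp (\<nu> * of_real s) * eta \<alpha> x s \<partial>lborel)
    \<and> boldW \<alpha> \<nu> x = 2 * (LINT s:{0..}|lborel. cosh (\<nu> * of_real s) * eta \<alpha> x s)"
proof -
  let ?f = "\<lambda>\<nu> s. exp (\<nu> * of_real s) * eta \<alpha> x s" and ?g = "\<lambda>s. cosh (\<nu> * of_real s) * eta \<alpha> x s"
  have int: "integrable lborel (?f \<nu>)" for \<nu>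
    unfolding exp_mult_eta using assms
    by (intro integrable_mult_right integrable_cosh_integrand_damped_D) simp
  have boldW: "boldW \<alpha> \<nu> x = integral\<^sup>L lborel (?f \<nu>)"
    unfolding exp_mult_eta boldW_eq_cosh_integral[OF assms] cosh_integral_def by simp
  have reflect: "integral\<^sup>L lborel (?f (- \<nu>)) = integral\<^sup>L lborel (?f \<nu>)"
    by (subst lborel_integral_real_affine[where c = "-1" and t = 0]) (simp_all add: eta_minus)
  have g: "?g = (\<lambda>s. (?f \<nu> s + ?f (- \<nu>) s) / 2)"
    by (simp add: cosh_field_def fun_eq_iff field_simps)
  have int_g: "integrable lborel ?g"
    unfolding g by (intro integrable_divide Bochner_Integration.integrable_add int)
  then have set_int_g: "set_integrable lborel {0..} ?g"
    by (simp add: set_integrable_def integrable_mult_indicator)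
  have "integral\<^sup>L lborel ?g = integral\<^sup>L lborel (?f \<nu>)"
    unfolding g using int[of \<nu>] int[of "- \<nu>"] reflect by simp
  then show ?thesis
    using integral_even_eq_twice[OF int_g] int set_int_g boldW
    by (simp add: eta_minus scaleR_conv_of_real)
qed

end
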